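(* Every graph $G$ has a tree-decomposition $(T,(P_t)_{t\in V(T)})$ of finite adhesion such that the ends of $T$ define precisely the topological ends of $G$.
   Context: Graphs may be infinite. A vertex-end of a graph $G$ is an equivalence class of rays (one-way infinite paths), where two rays are equivalent if they cannot be separated in $G$ by removing finitely many vertices. For a tree $T$, vertex-ends are simply called ends. A vertex $v$ dominates a vertex-end $\omega$ if for some (equivalently: every) ray $R$ belonging to $\omega$ there is an infinite fan of $v$-$R$-paths that are vertex-disjoint except at $v$. A topological end of $G$ is a vertex-end of $G$ that is not dominated by any vertex. A tree-decomposition of $G$ consists of a tree $T$ together with a family of subgraphs $(P_t\mid t\in V(T))$ of $G$ (the parts) such that every vertex and edge of $G$ is in at least one of these subgraphs, and such that if $v$ is a vertex of both $P_t$ and $P_w$, then it is a vertex of each $P_u$ where $u$ lies on the $t$-$w$-path in $T$. Its adhesion is finite if adjacent parts (parts $P_t,P_u$ with $tu\in E(T)$) intersect only in finitely many vertices. For a directed edge $tu$ of $T$, let $T_t$ and $T_u$ be the components of $T-tu$ containing $t$ and $u$; the separation corresponding to $tu$ is $(A_t,A_u)$, where $A_i$ is the union of the vertex sets of all parts $P_x$ with $x\in T_i$. Given a tree-decomposition of finite adhesion and a vertex-end $\omega$ of $G$, let $O(\omega)$ be the set of oriented edges $tu$ of $T$ such that $\omega$ lives in $A_u$, i.e. $A_u$ includes a ray belonging to $\omega$. $O(\omega)$ contains precisely one of the directions $tu$, $ut$ of each edge, and this orientation of $T$ points towards a node of $T$ or towards an end of $T$; we say that $\omega$ lives in the part of that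 node, or in that end, respectively. The ends of $T$ define precisely a set $\Psi$ of vertex-ends of $G$ if in every end of $T$ there lives a unique vertex-end of $G$ and it is in $\Psi$, and conversely every vertex-end in $\Psi$ lives in some end of $T$. *)

theory Defs
  imports Main
begin

text \<open>
  Graphs are simple, undirected and possibly infinite. An edge is the two-element set of its
  endvertices.
\<close>

record 'a ugraph =
  verts :: "'a set"
  edges :: "'a set set"

definition graph :: "'a ugraph \<Rightarrow> bool" where
  "graph G \<longleftrightarrow> (\<forall>e\<in>edges G. e \<subseteq> verts G \<and> card e = 2)"

definition subgraph :: "'a ugraph \<Rightarrow> 'a ugraph \<Rightarrow> bool" where
  "subgraph H G \<longleftrightarrow> graph H \<and> verts H \<subseteq> verts G \<and> edges H \<subseteq> edges G"

definition del_verts :: "'a ugraph \<Rightarrow> 'a set \<Rightarrow> 'a ugraph" where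
  "del_verts G X = \<lparr>verts = verts G - X, edges = {e \<in> edges G. e \<inter> X = {}}\<rparr>"

definition del_edge :: "'a ugraph \<Rightarrow> 'a set \<Rightarrow> 'a ugraph" where
  "del_edge G e = \<lparr>verts = verts G, edges = edges G - {e}\<rparr>"

definition path :: "'a ugraph \<Rightarrow> 'a list \<Rightarrow> bool" where
  "path G p \<longleftrightarrow> p \<noteq> [] \<and> distinct p \<and> set p \<subseteq> verts G \<and>
     successively (\<lambda>u v. {u, v} \<in> edges G) p"

definition path_between :: "'a ugraph \<Rightarrow> 'a \<Rightarrow> 'a list \<Rightarrow> 'a \<Rightarrow> bool" where
  "path_between G u p v \<longleftrightarrow> path G p \<and> hd p = u \<and> last p = v"

definition component_of :: "'a ugraph \<Rightarrow> 'a \<Rightarrow> 'a set" where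
  "component_of G u = {v. \<exists>p. path_between G u p v}"

definition cycle :: "'a ugraph \<Rightarrow> 'a list \<Rightarrow> bool" where
  "cycle G p \<longleftrightarrow> path G p \<and> length p \<ge> 3 \<and> {last p, hd p} \<in> edges G"

definition tree :: "'a ugraph \<Rightarrow> bool" where
  "tree T \<longleftrightarrow> graph T \<and> verts T \<noteq> {} \<and>
     (\<forall>u\<in>verts T. \<forall>v\<in>verts T. \<exists>p. path_between T u p v) \<and>
     (\<nexists>p. cycle T p)"

definition ray :: "'a ugraph \<Rightarrow> (nat \<Rightarrow> 'a) \<Rightarrow> bool" where
  "ray G R \<longleftrightarrow> inj R \<and> range R \<subseteq> verts G \<and> (\<forall>i. {R i, R (Suc i)} \<in> edges G)"

text \<open>
  Two rays are not separated by \<open>X\<close> if they have tails in the same component of \<open>G - X\<close>.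
\<close>

definition ray_equiv :: "'a ugraph \<Rightarrow> ((nat \<Rightarrow> 'a) \<times> (nat \<Rightarrow> 'a)) set" where
  "ray_equiv G = {(R, S). ray G R \<and> ray G S \<and>
     (\<forall>X. finite X \<and> X \<subseteq> verts G \<longrightarrow>
        (\<exists>m n. R ` {m..} \<inter> X = {} \<and> S ` {n..} \<inter> X = {} \<and>
               S n \<in> component_of (del_verts G X) (R m)))}"

definition vertex_ends :: "'a ugraph \<Rightarrow> (nat \<Rightarrow> 'a) set set" where
  "vertex_ends G = {R. ray G R} // ray_equiv G"

text \<open>
  A path from \<open>v\<close> to \<open>R\<close> meets \<open>R\<close> only in its last vertex. If \<open>v\<close> itself lies on \<open>R\<close>, it is
  additionally allowed as the starting vertex, so that domination does not depend on the choice
  of the ray in the vertex-end.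
\<close>

definition path_to_ray :: "'a ugraph \<Rightarrow> 'a \<Rightarrow> (nat \<Rightarrow> 'a) \<Rightarrow> 'a list \<Rightarrow> bool" where
  "path_to_ray G v R p \<longleftrightarrow> path G p \<and> hd p = v \<and> last p \<in> range R \<and>
     set p \<inter> range R \<subseteq> {v, last p}"

definition dominates :: "'a ugraph \<Rightarrow> 'a \<Rightarrow> (nat \<Rightarrow> 'a) set \<Rightarrow> bool" where
  "dominates G v \<omega> \<longleftrightarrow> (\<exists>R\<in>\<omega>. \<exists>F. infinite F \<and> (\<forall>p\<in>F. path_to_ray G v R p) \<and>
     (\<forall>p\<in>F. \<forall>q\<in>F. p \<noteq> q \<longrightarrow> set p \<inter> set q = {v}))"

definition topological_ends :: "'a ugraph \<Rightarrow> (nat \<Rightarrow> 'a) set set" where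
  "topological_ends G = {\<omega> \<in> vertex_ends G. \<not> (\<exists>v\<in>verts G. dominates G v \<omega>)}"

definition tree_decomposition ::
    "'a ugraph \<Rightarrow> 'b ugraph \<Rightarrow> ('b \<Rightarrow> 'a ugraph) \<Rightarrow> bool" where
  "tree_decomposition G T P \<longleftrightarrow> tree T \<and>
     (\<forall>t\<in>verts T. subgraph (P t) G) \<and>
     (\<forall>v\<in>verts G. \<exists>t\<in>verts T. v \<in> verts (P t)) \<and>
     (\<forall>e\<in>edges G. \<exists>t\<in>verts T. e \<in> edges (P t)) \<and>
     (\<forall>t\<in>verts T. \<forall>w\<in>verts T. \<forall>p. path_between T t p w \<longrightarrow>
        (\<forall>u\<in>set p. verts (P t) \<inter> verts (P w) \<subseteq> verts (P u)))"

definition finite_adhesion :: "'b ugraph \<Rightarrow> ('b \<Rightarrow> 'a ugraph) \<Rightarrow> bool" where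
  "finite_adhesion T P \<longleftrightarrow>
     (\<forall>t u. {t, u} \<in> edges T \<longrightarrow> finite (verts (P t) \<inter> verts (P u)))"

text \<open>
  For an edge \<open>tu\<close> of \<open>T\<close>, the set \<open>tree_side T t u\<close> is \<open>T\<^sub>u\<close> and \<open>side T P t u\<close> is \<open>A\<^sub>u\<close>.
\<close>

definition tree_side :: "'b ugraph \<Rightarrow> 'b \<Rightarrow> 'b \<Rightarrow> 'b set" where
  "tree_side T t u = component_of (del_edge T {t, u}) u"

definition side :: "'b ugraph \<Rightarrow> ('b \<Rightarrow> 'a ugraph) \<Rightarrow> 'b \<Rightarrow> 'b \<Rightarrow> 'a set" where
  "side T P t u = (\<Union>x\<in>tree_side T t u. verts (P x))"

definition lives_in_set :: "(nat \<Rightarrow> 'a) set \<Rightarrow> 'a set \<Rightarrow> bool" where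
  "lives_in_set \<omega> A \<longleftrightarrow> (\<exists>R\<in>\<omega>. range R \<subseteq> A)"

definition orientation_of ::
    "'b ugraph \<Rightarrow> ('b \<Rightarrow> 'a ugraph) \<Rightarrow> (nat \<Rightarrow> 'a) set \<Rightarrow> ('b \<times> 'b) set" where
  "orientation_of T P \<omega> = {(t, u). {t, u} \<in> edges T \<and> lives_in_set \<omega> (side T P t u)}"

text \<open>
  An orientation of \<open>T\<close> points towards an end \<open>\<eta>\<close> of \<open>T\<close> if it orients each edge \<open>tu\<close> from \<open>t\<close>
  to \<open>u\<close> exactly when \<open>\<eta>\<close> has a ray in \<open>T\<^sub>u\<close>.
\<close>

definition points_towards_end ::
    "'b ugraph \<Rightarrow> ('b \<times> 'b) set \<Rightarrow> (nat \<Rightarrow> 'b) set \<Rightarrow> bool" where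
  "points_towards_end T Or \<eta> \<longleftrightarrow>
     Or = {(t, u). {t, u} \<in> edges T \<and> lives_in_set \<eta> (tree_side T t u)}"

definition lives_in_end ::
    "'b ugraph \<Rightarrow> ('b \<Rightarrow> 'a ugraph) \<Rightarrow> (nat \<Rightarrow> 'a) set \<Rightarrow> (nat \<Rightarrow> 'b) set \<Rightarrow> bool" where
  "lives_in_end T P \<omega> \<eta> \<longleftrightarrow> points_towards_end T (orientation_of T P \<omega>) \<eta>"

definition ends_define_precisely ::
    "'a ugraph \<Rightarrow> 'b ugraph \<Rightarrow> ('b \<Rightarrow> 'a ugraph) \<Rightarrow> (nat \<Rightarrow> 'a) set set \<Rightarrow> bool" where
  "ends_define_precisely G T P \<Psi> \<longleftrightarrow>
     (\<forall>\<eta>\<in>vertex_ends T.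
        (\<exists>!\<omega>. \<omega> \<in> vertex_ends G \<and> lives_in_end T P \<omega> \<eta>) \<and>
        (\<forall>\<omega>\<in>vertex_ends G. lives_in_end T P \<omega> \<eta> \<longrightarrow> \<omega> \<in> \<Psi>)) \<and>
     (\<forall>\<omega>\<in>\<Psi>. \<exists>\<eta>\<in>vertex_ends T. lives_in_end T P \<omega> \<eta>)"

text \<open>
  The nodes of the decomposition tree are taken from a fixed type, as one cannot quantify
  existentially over types. The type \<open>'a set list\<close> is large enough for this to be no restriction:
  if \<open>T\<close> has finite adhesion and its ends define precisely a set of vertex-ends of \<open>G\<close>,
  then the same holds for any subtree of \<open>T\<close> whose parts cover \<open>G\<close>, and there is such a subtree with at most
  \<open>max |V(G)| \<aleph>\<^sub>0\<close> nodes.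
\<close>

type_synonym 'a node = "'a set list"

end

theory Submission
  imports Defs "HOL-Library.Sublist"
begin


section \<open>Reachability and finite boundaries\<close>

text \<open>Ends are studied through vertex sets with finite neighbourhood
  (\<open>finite_cut\<close>). Two rays are equivalent iff every such set that contains a tail of
  one contains a tail of the other (\<open>ray_equiv_iff\<close>). A vertex v dominates the end of R
  iff every finite cut D containing a tail of R has v in D or in the neighbourhood of D
  (\<open>dominates_iff\<close>).

  The heart of the proof is an increasing sequence of vertex sets U n exhausting the graph
  (\<open>exhaustion_exists\<close>), with three properties: U (n+1) includes U n and its
  neighbourhood; every component of G - U n has a finite neighbourhood; every undominated end is far
  from every U n, that is, some finite cut around the end avoids U n. Adding a neighbourhood keeps
  undominated ends far (\<open>far_nbh\<close>). Passing to an envelope makes the neighbourhoods of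
  the remaining components finite and keeps every end far that was far before
  (\<open>envelope\<close>); this rests on a form of the star-comb lemma (\<open>star_comb\<close>).

  The nodes of the tree are the finite descending chains of components of G - U 0, G - U 1, and so
  on. The part of a chain of length n consists of the vertices of U n in its smallest component,
  together with the neighbourhood of that component. Adjacent parts meet only in the neighbourhood
  of the smaller component, so the adhesion is finite.

  An end of the tree is an infinite chain of components C 0, C 1, and so on. The chain has empty
  intersection because the U n exhaust the graph, and the finite neighbourhoods of the C n leave
  every U k because U (k+1) includes the neighbourhood of U k. Hence some ray has a tail in every C
  n (\<open>branch_ray_exists\<close>), all such rays are equivalent
  (\<open>branch_ray_unique\<close>), and their end is undominated
  (\<open>branch_ray_undominated\<close>). Conversely, an undominated end is far from every U n, so
  it selects one component on each level and with them an infinite chain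
  (\<open>undominated_branch\<close>).\<close>

abbreviation adj :: "'a ugraph \<Rightarrow> 'a \<Rightarrow> 'a \<Rightarrow> bool" where
  "adj G x y \<equiv> {x, y} \<in> edges G"

text \<open>Reachability by walks rather than by the repetition-free lists of \<open>path\<close>:
  walks concatenate without shortcuts and allow induction on the last edge.\<close>

inductive conn :: "'a ugraph \<Rightarrow> 'a set \<Rightarrow> 'a \<Rightarrow> 'a \<Rightarrow> bool" for G A where
  conn_refl: "x \<in> A \<Longrightarrow> conn G A x x"
| conn_step: "conn G A x y \<Longrightarrow> adj G y z \<Longrightarrow> z \<in> A \<Longrightarrow> conn G A x z"

definition nbh :: "'a ugraph \<Rightarrow> 'a set \<Rightarrow> 'a set" where
  "nbh G D = {v \<in> verts G - D. \<exists>u\<in>D. adj G u v}"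

definition tail_in :: "(nat \<Rightarrow> 'a) \<Rightarrow> 'a set \<Rightarrow> bool" where
  "tail_in R D \<longleftrightarrow> (\<exists>m. \<forall>i\<ge>m. R i \<in> D)"

definition finite_cut :: "'a ugraph \<Rightarrow> 'a set \<Rightarrow> bool" where
  "finite_cut G D \<longleftrightarrow> D \<subseteq> verts G \<and> finite (nbh G D)"

lemma conn_in: "conn G A x y \<Longrightarrow> x \<in> A \<and> y \<in> A"
  by (induction rule: conn.induct) auto

lemma conn_trans: "conn G A y z \<Longrightarrow> conn G A x y \<Longrightarrow> conn G A x z"
  by (induction rule: conn.induct) (auto intro: conn.intros)

lemma conn_edge: "adj G x y \<Longrightarrow> x \<in> A \<Longrightarrow> y \<in> A \<Longrightarrow> conn G A x y"
  by (metis conn.intros)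

lemma conn_sym: "conn G A x y \<Longrightarrow> conn G A y x"
proof (induction rule: conn.induct)
  case (conn_step x y z)
  then have "conn G A z y"
    by (metis conn_edge conn_in insert_commute)
  then show ?case
    using conn_step conn_trans by metis
qed (auto intro: conn.intros)

lemma conn_mono: "conn G A x y \<Longrightarrow> A \<subseteq> B \<Longrightarrow> conn G B x y"
  by (induction rule: conn.induct) (auto intro: conn.intros)

section \<open>Tails of rays\<close>

lemma tail_in_mono: "tail_in R A \<Longrightarrow> A \<subseteq> B \<Longrightarrow> tail_in R B"
  by (auto simp: tail_in_def)

lemma tail_in_Int: "tail_in R A \<Longrightarrow> tail_in R B \<Longrightarrow> tail_in R (A \<inter> B)"
  unfolding tail_in_def by (metis IntI max.bounded_iff)

lemma tail_in_INT:
  assumes "finite I" "\<And>i. i \<in> I \<Longrightarrow> tail_in R (A i)"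
  shows "tail_in R (\<Inter>i\<in>I. A i)"
  using assms
proof (induction I rule: finite_induct)
  case empty
  then show ?case by (auto simp: tail_in_def)
next
  case (insert x F)
  then show ?case using tail_in_Int[of R "A x" "\<Inter>i\<in>F. A i"] by simp
qed

lemma tail_in_avoid_finite:
  assumes "inj R" "finite X"
  shows "tail_in R (- X)"
proof -
  have "finite (R -` X)"
    using assms by (simp add: finite_vimageI)
  then obtain m where "\<forall>i\<in>R -` X. i < m"
    using finite_nat_set_iff_bounded by blast
  then show ?thesis
    unfolding tail_in_def by (metis ComplI leD vimageI)
qed

lemma tail_in_meet: "tail_in R A \<Longrightarrow> tail_in R B \<Longrightarrow> \<exists>i. R i \<in> A \<and> R i \<in> B"
  unfolding tail_in_def by (meson max.cobounded1 max.cobounded2)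

lemma conn_tail:
  assumes "\<And>i. adj G (R i) (R (Suc i))" "\<And>i. i \<ge> m \<Longrightarrow> R i \<in> A" "i \<ge> m"
  shows "conn G A (R m) (R i)"
  using assms(3)
proof (induction i rule: dec_induct)
  case base
  then show ?case using assms(2) by (simp add: conn_refl)
next
  case (step n)
  then show ?case using conn_step[OF step.IH assms(1)] assms(2) by simp
qed

lemma tail_in_decreasing:
  assumes "finite X" "\<And>n. D (Suc n) \<subseteq> (D n :: 'a set)" "(\<Inter>n. D n) = {}"
  shows "\<exists>n. X \<inter> D n = {}"
  using assms(1)
proof (induction X rule: finite_induct)
  case (insert x F)
  obtain n where n: "F \<inter> D n = {}" using insert by blast
  obtain k where k: "x \<notin> D k" using assms(3) by blast
  have mono: "D (max n k) \<subseteq> D n" "D (max n k) \<subseteq> D k"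
    using lift_Suc_antimono_le[of D, OF assms(2)] by (meson max.cobounded1 max.cobounded2)+
  show ?case using n k mono by (intro exI[of _ "max n k"]) auto
qed auto

context
  fixes G :: "'a ugraph"
  assumes graph: "graph G"
begin

lemma adj_sym: "adj G x y \<Longrightarrow> adj G y x"
  by (simp add: insert_commute)

lemma adj_verts: "adj G x y \<Longrightarrow> x \<in> verts G \<and> y \<in> verts G"
  using graph by (auto simp: graph_def)

lemma path_conn:
  assumes "path_between G u p v"
  shows "conn G (set p) u v"
proof -
  have "p \<noteq> [] \<Longrightarrow> successively (\<lambda>u v. {u, v} \<in> edges G) p \<Longrightarrow> conn G (set p) (hd p) (last p)" for p
  proof (induction p rule: rev_nonempty_induct)
    case (single x)
    then show ?case by (auto intro: conn.intros)
  next
    case (snoc x xs)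
    then have "conn G (set xs) (hd xs) (last xs)" "adj G (last xs) x"
      by (auto simp: successively_append_iff)
    then have "conn G (set (xs @ [x])) (hd xs) (last xs)" "adj G (last xs) x"
      by (auto elim: conn_mono)
    then show ?case using snoc by (auto intro: conn_step)
  qed
  then show ?thesis using assms by (auto simp: path_between_def path_def)
qed

lemma conn_path:
  assumes "conn G A u v" "A \<subseteq> verts G"
  shows "\<exists>p. path_between G u p v \<and> set p \<subseteq> A"
  using assms
proof (induction rule: conn.induct)
  case (conn_refl x)
  then show ?case by (intro exI[of _ "[x]"]) (auto simp: path_between_def path_def)
next
  case (conn_step x y z)
  then obtain p where p: "path_between G x p y" "set p \<subseteq> A" by blast
  show ?case
  proof (cases "z \<in> set p")
    case True
    \<comment> \<open>The walk has returned to a vertex of the path, so the initial segment ending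
      in \<open>z\<close> already suffices.\<close>
    then obtain as bs where "p = as @ z # bs" by (auto simp: in_set_conv_decomp)
    with p have "path_between G x (as @ [z]) z \<and> set (as @ [z]) \<subseteq> A"
      by (cases as; cases "tl as")
        (auto simp: path_between_def path_def successively_append_iff successively_Cons split: if_splits)
    then show ?thesis by blast
  next
    case False
    with p conn_step have "path_between G x (p @ [z]) z \<and> set (p @ [z]) \<subseteq> A"
      by (auto simp: path_between_def path_def successively_append_iff)
    then show ?thesis by blast
  qed
qed

lemma component_of_conn: "component_of G u = {v. conn G (verts G) u v}"
proof -
  have "conn G (verts G) u v" if "path_between G u p v" for p v
    using path_conn[OF that] that by (auto intro: conn_mono simp: path_between_def path_def)
  then show ?thesis
    unfolding component_of_def using conn_path[OF _ order_refl] by blast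
qed

lemma component_of_del_verts: "component_of (del_verts G X) u = {v. conn G (verts G - X) u v}"
proof -
  have *: "path_between (del_verts G X) u p v \<longleftrightarrow> path_between G u p v \<and> set p \<subseteq> verts G - X" for p v
  proof -
    have "successively (\<lambda>u v. {u, v} \<in> edges (del_verts G X)) p \<longleftrightarrow>
        successively (\<lambda>u v. {u, v} \<in> edges G) p" if "set p \<subseteq> verts G - X"
      using that by (intro successively_cong) (auto simp: del_verts_def)
    then show ?thesis
      by (auto simp: path_between_def path_def) (auto simp: del_verts_def)
  qed
  show ?thesis
    unfolding component_of_def *
    using conn_path[of "verts G - X"] path_conn conn_mono by fastforce
qed

text \<open>A walk can leave \<open>D\<close> only through a vertex of \<open>nbh G D\<close>, and
  \<open>A\<close> contains none.\<close>

lemma conn_stays: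
  assumes "conn G A x y" "x \<in> D" "A \<inter> nbh G D = {}"
  shows "y \<in> D"
  using assms
proof (induction rule: conn.induct)
  case (conn_step x y z)
  then show ?case using adj_verts[of y z] by (auto simp: nbh_def)
qed auto

lemma nbh_comp: "nbh G {y. conn G (verts G - X) x y} \<subseteq> X"
  using conn_step[of G "verts G - X"] by (auto simp: nbh_def)

section \<open>Finite cuts and the ends on their sides\<close>

lemma cut_comp: "finite X \<Longrightarrow> finite_cut G {y. conn G (verts G - X) x y}"
  using nbh_comp[of X x] conn_in[of G "verts G - X"] by (auto simp: finite_cut_def finite_subset)

lemma cut_Int: "finite_cut G D \<Longrightarrow> finite_cut G D' \<Longrightarrow> finite_cut G (D \<inter> D')"
proof -
  have "nbh G (D \<inter> D') \<subseteq> nbh G D \<union> nbh G D'" by (auto simp: nbh_def)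
  then show "finite_cut G D \<Longrightarrow> finite_cut G D' \<Longrightarrow> finite_cut G (D \<inter> D')"
    by (auto simp: finite_cut_def intro: finite_subset)
qed

lemma cut_INT:
  assumes "finite I" "finite_cut G D" "\<And>i. i \<in> I \<Longrightarrow> finite_cut G (A i)"
  shows "finite_cut G (D \<inter> (\<Inter>i\<in>I. A i))"
  using assms
proof (induction I rule: finite_induct)
  case (insert x F)
  then show ?case using cut_Int[of "A x" "D \<inter> (\<Inter>i\<in>F. A i)"] by (simp add: Int_left_commute)
qed auto

lemma cut_Diff_finite: "finite_cut G D \<Longrightarrow> finite X \<Longrightarrow> finite_cut G (D - X)"
proof -
  have "nbh G (D - X) \<subseteq> nbh G D \<union> X" by (auto simp: nbh_def)
  then show "finite_cut G D \<Longrightarrow> finite X \<Longrightarrow> finite_cut G (D - X)"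
    by (auto simp: finite_cut_def intro: finite_subset)
qed

text \<open>A vertex with a neighbour in \<open>D\<close> lies in \<open>D\<close> or in
  \<open>nbh G D\<close>, so the far side of the cut can have neighbours only in
  \<open>nbh G D\<close>. This makes the complement available as a test set too.\<close>

lemma cut_outside: "finite_cut G D \<Longrightarrow> finite_cut G (verts G - D - nbh G D)"
proof -
  have "nbh G (verts G - D - nbh G D) \<subseteq> nbh G D"
    using adj_sym by (auto simp: nbh_def)
  then show "finite_cut G D \<Longrightarrow> finite_cut G (verts G - D - nbh G D)"
    by (auto simp: finite_cut_def intro: finite_subset)
qed

lemma ray_stays:
  assumes "ray G R" "R m \<in> D" "\<And>i. i \<ge> m \<Longrightarrow> R i \<notin> nbh G D" "i \<ge> m"
  shows "R i \<in> D"
  using assms(4)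
proof (induction i rule: dec_induct)
  case (step n)
  then show ?case using assms(1) assms(3)[of "Suc n"] by (auto simp: nbh_def ray_def)
qed (use assms in auto)

text \<open>Being injective, a ray meets the finite neighbourhood only finitely often; afterwards it
  can no longer change sides.\<close>

lemma ray_decides:
  assumes "ray G R" "finite_cut G D"
  shows "tail_in R D \<or> tail_in R (verts G - D - nbh G D)"
proof -
  obtain m where m: "\<And>i. i \<ge> m \<Longrightarrow> R i \<notin> nbh G D"
    using tail_in_avoid_finite[of R "nbh G D"] assms by (auto simp: ray_def finite_cut_def tail_in_def)
  show ?thesis
  proof (cases "\<exists>k\<ge>m. R k \<in> D")
    case True
    then show ?thesis
      using ray_stays[OF assms(1)] m unfolding tail_in_def by (meson order_trans)
  next
    case False
    have "R i \<in> verts G" for i using assms(1) by (auto simp: ray_def)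
    with False m have "\<forall>i\<ge>m. R i \<in> verts G - D - nbh G D" by auto
    then show ?thesis unfolding tail_in_def by blast
  qed
qed

lemma tail_in_outside_iff:
  assumes "ray G R" "finite_cut G D"
  shows "tail_in R (verts G - D) \<longleftrightarrow> \<not> tail_in R D"
    using ray_decides[OF assms] tail_in_meet[of R D "verts G - D"] tail_in_mono[of R _ "verts G - D"]
    by blast

lemma ray_shift:
  assumes "ray G R"
  shows "ray G (\<lambda>i. R (i + m))"
  using assms by (auto simp: ray_def intro!: injI dest: injD)

text \<open>Finite separators and finite cuts carry the same information: a cut gives the separator
  \<open>nbh G D\<close>, and a separator \<open>X\<close> gives the component of G - X that
  contains a tail of R. From here on, ends are handled through cuts only.\<close>

lemma ray_equiv_iff:
  "(R, S) \<in> ray_equiv G \<longleftrightarrow> ray G R \<and> ray G S \<and> (\<forall>D. finite_cut G D \<longrightarrow> tail_in R D \<longrightarrow> tail_in S D)"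
proof (intro iffI conjI allI impI)
  assume RS: "(R, S) \<in> ray_equiv G"
  then show r: "ray G R" and s: "ray G S" by (auto simp: ray_equiv_def)
  fix D assume D: "finite_cut G D" "tail_in R D"
  then have "finite (nbh G D)" "nbh G D \<subseteq> verts G" by (auto simp: finite_cut_def nbh_def)
  with RS have "\<exists>m n. R ` {m..} \<inter> nbh G D = {} \<and> S ` {n..} \<inter> nbh G D = {} \<and>
      conn G (verts G - nbh G D) (R m) (S n)"
    by (simp add: ray_equiv_def component_of_del_verts)
  then obtain m n where mn: "R ` {m..} \<inter> nbh G D = {}" "S ` {n..} \<inter> nbh G D = {}"
    "conn G (verts G - nbh G D) (R m) (S n)"
    by blast
  \<comment> \<open>Only later vertices of R are known to lie in \<open>D\<close>. The segment of R
    leading to one of them avoids \<open>nbh G D\<close>, so it does not leave \<open>D\<close> when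
    followed backwards.\<close>
  have "R m \<in> D"
  proof (rule ccontr)
    assume "R m \<notin> D"
    obtain k where k: "\<forall>i\<ge>k. R i \<in> D" using D by (auto simp: tail_in_def)
    have "conn G (verts G - nbh G D) (R m) (R (max m k))"
      using mn r by (intro conn_tail) (auto simp: ray_def)
    then have "R m \<in> D"
      using conn_stays[OF conn_sym, of "verts G - nbh G D" "R m" "R (max m k)" D] k by auto
    then show False using \<open>R m \<notin> D\<close> by simp
  qed
  then have "S n \<in> D" using conn_stays[OF mn(3)] by auto
  then have "S i \<in> D" if "i \<ge> n" for i
    using ray_stays[OF s, of n D i] mn that by auto
  then show "tail_in S D" by (auto simp: tail_in_def)
next
  assume *: "ray G R \<and> ray G S \<and> (\<forall>D. finite_cut G D \<longrightarrow> tail_in R D \<longrightarrow> tail_in S D)"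
  have "\<exists>m n. R ` {m..} \<inter> X = {} \<and> S ` {n..} \<inter> X = {} \<and> conn G (verts G - X) (R m) (S n)"
    if X: "finite X" "X \<subseteq> verts G" for X
  proof -
    obtain m where m: "\<And>i. i \<ge> m \<Longrightarrow> R i \<notin> X"
      using tail_in_avoid_finite[of R X] X * by (auto simp: ray_def tail_in_def)
    let ?D = "{y. conn G (verts G - X) (R m) y}"
    have "R i \<in> ?D" if "i \<ge> m" for i
      using that m * by (auto simp: ray_def intro!: conn_tail)
    then have "tail_in R ?D" by (auto simp: tail_in_def)
    then have "tail_in S ?D" using * cut_comp[OF X(1)] by blast
    then obtain n where n: "\<forall>i\<ge>n. S i \<in> ?D" by (auto simp: tail_in_def)
    then have "\<forall>i\<ge>n. S i \<notin> X" using conn_in[of G "verts G - X"] by blast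
    with n m show ?thesis by (intro exI[of _ m] exI[of _ n]) auto
  qed
  then show "(R, S) \<in> ray_equiv G"
    using * unfolding ray_equiv_def component_of_del_verts by auto
qed

text \<open>The converse direction comes from applying the criterion to the far side of the cut,
  which is again a finite cut.\<close>

lemma ray_equiv_tail_iff:
  assumes "(R, S) \<in> ray_equiv G" "finite_cut G D"
  shows "tail_in R D \<longleftrightarrow> tail_in S D"
proof
  assume S: "tail_in S D"
  show "tail_in R D"
  proof (rule ccontr)
    assume "\<not> tail_in R D"
    then have "tail_in R (verts G - D - nbh G D)"
      using assms ray_decides[of R D] by (auto simp: ray_equiv_iff)
    then have "tail_in S (verts G - D - nbh G D)"
      using assms cut_outside[of D] by (auto simp: ray_equiv_iff)
    with S show False using tail_in_meet by fastforce
  qed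
qed (use assms in \<open>auto simp: ray_equiv_iff\<close>)

lemma equiv_ray_equiv: "equiv {R. ray G R} (ray_equiv G)"
proof (intro equivI)
  show "ray_equiv G \<subseteq> {R. ray G R} \<times> {R. ray G R}" by (auto simp: ray_equiv_def)
  show "refl_on {R. ray G R} (ray_equiv G)"
    by (auto simp: refl_on_def ray_equiv_iff)
  show "sym (ray_equiv G)"
  proof (rule symI)
    fix R S assume RS: "(R, S) \<in> ray_equiv G"
    then show "(S, R) \<in> ray_equiv G"
      using ray_equiv_tail_iff[OF RS] unfolding ray_equiv_iff by blast
  qed
  show "trans (ray_equiv G)"
    by (auto simp: trans_def ray_equiv_iff)
qed

lemma vertex_end_of_ray: "ray G R \<Longrightarrow> ray_equiv G `` {R} \<in> vertex_ends G"
  unfolding vertex_ends_def by (rule quotientI) simp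

lemma vertex_endE:
  assumes "\<omega> \<in> vertex_ends G"
  obtains R where "ray G R" "R \<in> \<omega>" "\<omega> = ray_equiv G `` {R}"
proof -
  obtain R where R: "R \<in> {R. ray G R}" "\<omega> = ray_equiv G `` {R}"
    using assms unfolding vertex_ends_def by (rule quotientE)
  with equiv_class_self[OF equiv_ray_equiv R(1)] show ?thesis
    by (intro that[of R]) auto
qed

lemma vertex_end_class:
  assumes "\<omega> \<in> vertex_ends G" "R \<in> \<omega>"
  shows "ray G R" "\<omega> = ray_equiv G `` {R}"
proof -
  obtain S where S: "\<omega> = ray_equiv G `` {S}" using assms(1) by (rule vertex_endE)
  then have SR: "(S, R) \<in> ray_equiv G" using assms(2) by simp
  then show "ray G R" by (simp add: ray_equiv_iff)
  show "\<omega> = ray_equiv G `` {R}"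
    using S equiv_class_eq[OF equiv_ray_equiv SR] by simp
qed

lemma shift_in_vertex_end:
  assumes "\<omega> \<in> vertex_ends G" "R \<in> \<omega>"
  shows "(\<lambda>i. R (i + m)) \<in> \<omega>"
proof -
  have "tail_in R D \<Longrightarrow> tail_in (\<lambda>i. R (i + m)) D" for D
    unfolding tail_in_def by (metis trans_le_add1)
  then have "(R, \<lambda>i. R (i + m)) \<in> ray_equiv G"
    using vertex_end_class[OF assms] ray_shift by (auto simp: ray_equiv_iff)
  then show ?thesis using vertex_end_class[OF assms] by auto
qed

lemma lives_if_tail_in:
  assumes "\<omega> \<in> vertex_ends G" "R \<in> \<omega>" "tail_in R A"
  shows "lives_in_set \<omega> A"
proof -
  obtain m where m: "\<forall>i\<ge>m. R i \<in> A" using assms by (auto simp: tail_in_def)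
  then show ?thesis
    using shift_in_vertex_end[OF assms(1,2), of m]
    by (auto simp: lives_in_set_def intro!: bexI[of _ "\<lambda>i. R (i + m)"])
qed

text \<open>Finitely many extra vertices cannot hold a tail of a ray. The surplus
  \<open>A - D\<close> is allowed because a side of the decomposition will be a component together
  with its finite neighbourhood.\<close>

lemma lives_in_cut_iff:
  assumes "\<omega> \<in> vertex_ends G" "R \<in> \<omega>" "finite_cut G D" "D \<subseteq> A" "finite (A - D)"
  shows "lives_in_set \<omega> A \<longleftrightarrow> tail_in R D"
proof
  assume "lives_in_set \<omega> A"
  then obtain S where S: "S \<in> \<omega>" "range S \<subseteq> A" by (auto simp: lives_in_set_def)
  then have RS: "(R, S) \<in> ray_equiv G" using vertex_end_class[OF assms(1,2)] by auto
  then have "inj S" by (auto simp: ray_equiv_iff ray_def)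
  then have "tail_in S (A \<inter> - (A - D))"
    using S assms by (intro tail_in_Int tail_in_avoid_finite) (auto simp: tail_in_def)
  then have "tail_in S D" by (rule tail_in_mono) auto
  then show "tail_in R D" using RS assms ray_equiv_tail_iff by blast
next
  assume "tail_in R D"
  then show "lives_in_set \<omega> A"
    using lives_if_tail_in[OF assms(1,2)] tail_in_mono assms(4) by blast
qed

lemma lives_outside_cut_iff:
  assumes "\<omega> \<in> vertex_ends G" "R \<in> \<omega>" "finite_cut G D"
  shows "lives_in_set \<omega> (verts G - D) \<longleftrightarrow> \<not> tail_in R D"
proof
  assume "lives_in_set \<omega> (verts G - D)"
  then obtain S where S: "S \<in> \<omega>" "range S \<subseteq> verts G - D" by (auto simp: lives_in_set_def)
  then have RS: "(R, S) \<in> ray_equiv G" using vertex_end_class[OF assms(1,2)] by auto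
  have "\<not> tail_in S D" using S by (auto simp: tail_in_def)
  then show "\<not> tail_in R D" using RS assms ray_equiv_tail_iff by blast
next
  assume "\<not> tail_in R D"
  then show "lives_in_set \<omega> (verts G - D)"
    using lives_if_tail_in[OF assms(1,2)] tail_in_outside_iff vertex_end_class[OF assms(1,2)] assms(3)
    by blast
qed

end


section \<open>Domination\<close>

context
  fixes G :: "'a ugraph"
  assumes graph: "graph G"
begin

text \<open>Otherwise v lies outside \<open>D\<close> and its neighbourhood. The paths of the fan
  end in distinct vertices of R, all but finitely many of them in \<open>D\<close>; each such path
  crosses \<open>nbh G D\<close>, and distinct paths do so in distinct vertices. That is impossible
  for a finite neighbourhood.\<close>

lemma fan_meets_cut:
  assumes R: "ray G R" and D: "finite_cut G D" "tail_in R D" and v: "v \<notin> D"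
    and F: "infinite F" "\<And>p. p \<in> F \<Longrightarrow> path_to_ray G v R p"
      "\<And>p q. p \<in> F \<Longrightarrow> q \<in> F \<Longrightarrow> p \<noteq> q \<Longrightarrow> set p \<inter> set q = {v}"
  shows "v \<in> nbh G D"
proof (rule ccontr)
  assume nv: "v \<notin> nbh G D"
  \<comment> \<open>If v lies on R, the fan may contain the one-vertex path; it is the only path of
    the fan that ends in v.\<close>
  have trivial: "p = [v]" if "p \<in> F" "last p = v" for p
    using F(2)[OF that(1)] that(2)
    by (cases p) (auto simp: path_to_ray_def path_def dest: last_in_set split: if_splits)
  have inj: "inj_on last F"
  proof (rule inj_onI, rule ccontr)
    fix p q assume pq: "p \<in> F" "q \<in> F" "last p = last q" "p \<noteq> q"
    then have "last p \<in> set p \<inter> set q"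
      using F(2) by (metis IntI last_in_set path_def path_to_ray_def)
    then have "last p = v" using F(3)[OF pq(1,2,4)] by simp
    then show False using trivial pq by metis
  qed
  have "finite (range R - D)"
  proof -
    obtain m where m: "\<forall>i\<ge>m. R i \<in> D" using D(2) by (auto simp: tail_in_def)
    then have "range R - D \<subseteq> R ` {..<m}"
      using not_le by (auto simp: image_iff)
    then show ?thesis by (rule finite_subset) simp
  qed
  moreover have "last ` {p \<in> F. last p \<notin> D} \<subseteq> range R - D"
    using F(2) by (auto simp: path_to_ray_def)
  ultimately have "finite (last ` {p \<in> F. last p \<notin> D})"
    using finite_subset by blast
  moreover have "inj_on last {p \<in> F. last p \<notin> D}" using inj by (rule inj_on_subset) auto
  ultimately have "finite {p \<in> F. last p \<notin> D}" by (rule finite_imageD)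
  then have "infinite (F - {p \<in> F. last p \<notin> D})" using F(1) by simp
  moreover have "F - {p \<in> F. last p \<notin> D} = {p \<in> F. last p \<in> D}" by auto
  ultimately have inf: "infinite {p \<in> F. last p \<in> D}" by simp
  have "\<exists>x. x \<in> set p \<inter> nbh G D" if "p \<in> F" "last p \<in> D" for p
  proof (rule ccontr)
    assume "\<nexists>x. x \<in> set p \<inter> nbh G D"
    then have "set p \<inter> nbh G D = {}" by blast
    moreover have "conn G (set p) v (last p)"
      using F(2)[OF that(1)] by (intro path_conn[OF graph]) (auto simp: path_to_ray_def path_between_def)
    ultimately show False
      using conn_stays[OF graph conn_sym, of "set p" v "last p" D] that v by blast
  qed
  then obtain g where g: "\<And>p. p \<in> F \<Longrightarrow> last p \<in> D \<Longrightarrow> g p \<in> set p \<inter> nbh G D" by metis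
  then have "inj_on g {p \<in> F. last p \<in> D}"
    by (intro inj_onI) (metis (mono_tags, lifting) F(3) IntD1 IntD2 IntI mem_Collect_eq nv singletonD)
  then have "infinite (g ` {p \<in> F. last p \<in> D})" using inf finite_image_iff by blast
  moreover have "g ` {p \<in> F. last p \<in> D} \<subseteq> nbh G D" using g by blast
  ultimately show False using D(1) by (meson finite_cut_def finite_subset)
qed

text \<open>The component of G - X containing a tail of R has its neighbourhood inside
  \<open>X\<close>. As v is not in \<open>X\<close> and cannot be cut off, v lies in that component
  and is joined to R there.\<close>

lemma fan_extend:
  assumes R: "ray G R" and v: "v \<in> verts G"
    and insep: "\<And>D. finite_cut G D \<Longrightarrow> tail_in R D \<Longrightarrow> v \<in> D \<union> nbh G D"
    and X: "finite X" "v \<notin> X"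
  shows "\<exists>p. path_to_ray G v R p \<and> last p \<noteq> v \<and> set p \<inter> X = {}"
proof -
  obtain m where m: "\<And>i. i \<ge> m \<Longrightarrow> R i \<notin> insert v X"
    using tail_in_avoid_finite[of R "insert v X"] X R by (auto simp: ray_def tail_in_def)
  let ?D = "{y. conn G (verts G - X) (R m) y}"
  have "R i \<in> ?D" if "i \<ge> m" for i
    using that m R by (auto simp: ray_def intro!: conn_tail)
  then have "tail_in R ?D" by (auto simp: tail_in_def)
  then have "v \<in> ?D" using insep[OF cut_comp[OF graph X(1)]] nbh_comp[OF graph, of X "R m"] X by blast
  then obtain p where "path_between G v p (R m)" "set p \<subseteq> verts G - X"
    using conn_path[OF graph conn_sym, of "verts G - X" "R m" v] by blast
  then have ex: "\<exists>p. path G p \<and> hd p = v \<and> last p \<in> range R - {v} \<and> set p \<subseteq> verts G - X"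
    using m[of m] by (auto simp: path_between_def)
  \<comment> \<open>In a shortest such path, a vertex of R other than v can only be the last one,
    since stopping at it earlier would give a shorter path.\<close>
  define p where "p = (ARG_MIN length p. path G p \<and> hd p = v \<and> last p \<in> range R - {v} \<and> set p \<subseteq> verts G - X)"
  have p: "path G p" "hd p = v" "last p \<in> range R - {v}" "set p \<subseteq> verts G - X"
    and min: "\<And>q. path G q \<Longrightarrow> hd q = v \<Longrightarrow> last q \<in> range R - {v} \<Longrightarrow> set q \<subseteq> verts G - X \<Longrightarrow>
      length p \<le> length q"
    using arg_min_nat_lemma[of "\<lambda>p. path G p \<and> hd p = v \<and> last p \<in> range R - {v} \<and> set p \<subseteq> verts G - X" _ length]
      ex unfolding p_def by blast+
  have "x = last p" if x: "x \<in> set p" "x \<in> range R" "x \<noteq> v" for x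
  proof -
    obtain as bs where ab: "p = as @ x # bs" using x(1) by (auto simp: in_set_conv_decomp)
    have "path G (as @ [x])" "hd (as @ [x]) = v"
      using p ab by (cases as; cases "tl as";
        auto simp: path_def successively_append_iff successively_Cons split: if_splits)+
    then have "length p \<le> length (as @ [x])"
      using p ab x by (intro min) auto
    then show ?thesis using ab by auto
  qed
  then have "path_to_ray G v R p" using p by (auto simp: path_to_ray_def)
  then show ?thesis using p by blast
qed

text \<open>A maximal fan exists by Zorn's lemma. If it were finite, \<open>fan_extend\<close> would
  provide a further path avoiding all its vertices except v.\<close>

lemma infinite_fan:
  assumes R: "ray G R" and v: "v \<in> verts G"
    and insep: "\<And>D. finite_cut G D \<Longrightarrow> tail_in R D \<Longrightarrow> v \<in> D \<union> nbh G D"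
  shows "\<exists>F. infinite F \<and> (\<forall>p\<in>F. path_to_ray G v R p) \<and>
     (\<forall>p\<in>F. \<forall>q\<in>F. p \<noteq> q \<longrightarrow> set p \<inter> set q = {v})"
proof -
  define \<A> where "\<A> = {F. (\<forall>p\<in>F. path_to_ray G v R p) \<and>
     (\<forall>p\<in>F. \<forall>q\<in>F. p \<noteq> q \<longrightarrow> set p \<inter> set q = {v})}"
  have "\<exists>M\<in>\<A>. \<forall>F\<in>\<A>. M \<subseteq> F \<longrightarrow> F = M"
  proof (rule subset_Zorn')
    fix C assume "subset.chain \<A> C"
    then have C: "C \<subseteq> \<A>" "\<And>F F'. F \<in> C \<Longrightarrow> F' \<in> C \<Longrightarrow> F \<subseteq> F' \<or> F' \<subseteq> F"
      by (auto simp: subset_chain_def)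
    have "set p \<inter> set q = {v}" if pq: "p \<in> F" "F \<in> C" "q \<in> F'" "F' \<in> C" "p \<noteq> q" for p q F F'
    proof -
      obtain H where "H \<in> C" "p \<in> H" "q \<in> H" using C(2)[of F F'] pq by blast
      moreover have "H \<in> \<A>" using C(1) \<open>H \<in> C\<close> by blast
      ultimately show ?thesis using pq(5) by (simp add: \<A>_def)
    qed
    then show "\<Union>C \<in> \<A>" using C(1) by (auto simp: \<A>_def)
  qed
  then obtain F where F: "F \<in> \<A>" and max: "\<And>F'. F' \<in> \<A> \<Longrightarrow> F \<subseteq> F' \<Longrightarrow> F' = F" by blast
  have "infinite F"
  proof
    assume "finite F"
    then obtain p where p: "path_to_ray G v R p" "last p \<noteq> v" "set p \<inter> (\<Union>(set ` F) - {v}) = {}"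
      using fan_extend[OF R v insep, of "\<Union>(set ` F) - {v}"] by auto
    have *: "r \<noteq> [] \<and> v \<in> set r \<and> last r \<in> set r" if "path_to_ray G v R r" for r
      using that by (auto simp: path_to_ray_def path_def)
    have "p \<notin> F" using p *[OF p(1)] by auto
    moreover have "set p \<inter> set q = {v}" if "q \<in> F" for q
      using p(3) *[OF p(1)] * that F by (auto simp: \<A>_def)
    then have "insert p F \<in> \<A>" using F p(1) by (auto simp: \<A>_def Int_commute)
    ultimately show False using max by blast
  qed
  then show ?thesis using F by (auto simp: \<A>_def)
qed

text \<open>Since equivalent rays have tails in the same finite cuts, R may be any ray of the end
  here, although \<open>dominates\<close> asks for a fan to just one ray.\<close>

lemma dominates_iff:
  assumes "\<omega> \<in> vertex_ends G" "R \<in> \<omega>" "v \<in> verts G"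
  shows "dominates G v \<omega> \<longleftrightarrow> (\<forall>D. finite_cut G D \<longrightarrow> tail_in R D \<longrightarrow> v \<in> D \<union> nbh G D)"
proof
  assume "dominates G v \<omega>"
  then obtain S F where S: "S \<in> \<omega>" "infinite F" "\<forall>p\<in>F. path_to_ray G v S p"
    "\<forall>p\<in>F. \<forall>q\<in>F. p \<noteq> q \<longrightarrow> set p \<inter> set q = {v}"
    unfolding dominates_def by blast
  have "(R, S) \<in> ray_equiv G" "ray G S"
    using vertex_end_class[OF graph assms(1)] assms(2) S(1) by auto
  then show "\<forall>D. finite_cut G D \<longrightarrow> tail_in R D \<longrightarrow> v \<in> D \<union> nbh G D"
    using ray_equiv_tail_iff[OF graph] fan_meets_cut[of S _ v F] S by blast
next
  assume "\<forall>D. finite_cut G D \<longrightarrow> tail_in R D \<longrightarrow> v \<in> D \<union> nbh G D"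
  then show "dominates G v \<omega>"
    unfolding dominates_def
    using infinite_fan[of R v] vertex_end_class(1)[OF graph assms(1,2)] assms(2,3) by blast
qed

end

section \<open>Envelopes\<close>

text \<open>\<open>far G R U\<close> says that the end of \<open>R\<close> is not in the closure of \<open>U\<close>.\<close>

definition far :: "'a ugraph \<Rightarrow> (nat \<Rightarrow> 'a) \<Rightarrow> 'a set \<Rightarrow> bool" where
  "far G R U \<longleftrightarrow> (\<exists>D. finite_cut G D \<and> tail_in R D \<and> finite (D \<inter> U))"

context
  fixes G :: "'a ugraph"
  assumes graph: "graph G"
begin

text \<open>The finite intersection can be removed from the cut: this adds finitely many vertices to
  the neighbourhood and costs the ray finitely many vertices.\<close>

lemma far_iff:
  assumes "ray G R"
  shows "far G R U \<longleftrightarrow> (\<exists>D. finite_cut G D \<and> tail_in R D \<and> D \<inter> U = {})"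
proof
  assume "far G R U"
  then obtain D where D: "finite_cut G D" "tail_in R D" "finite (D \<inter> U)" by (auto simp: far_def)
  have "finite_cut G (D - (D \<inter> U))" using D by (intro cut_Diff_finite[OF graph])
  moreover have "tail_in R (D \<inter> - (D \<inter> U))"
    using D assms by (intro tail_in_Int tail_in_avoid_finite) (auto simp: ray_def)
  then have "tail_in R (D - (D \<inter> U))" by (rule tail_in_mono) auto
  ultimately show "\<exists>D. finite_cut G D \<and> tail_in R D \<and> D \<inter> U = {}"
    by (intro exI[of _ "D - (D \<inter> U)"]) auto
qed (force simp: far_def)

text \<open>Let \<open>D\<close> be a cut around the end that avoids \<open>U\<close>. A vertex of
  \<open>D\<close> adjacent to some u in \<open>U\<close> has u in the finite set
  \<open>nbh G D\<close>. Since u does not dominate, some cut \<open>E u\<close> around the end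
  contains neither u nor a neighbour of u; intersecting \<open>D\<close> with these finitely many
  cuts removes all neighbours of \<open>U\<close>.\<close>

lemma far_nbh:
  assumes R: "ray G R" and far: "far G R U"
    and undom: "\<And>v. v \<in> verts G \<Longrightarrow> \<exists>D. finite_cut G D \<and> tail_in R D \<and> v \<notin> D \<union> nbh G D"
  shows "far G R (U \<union> nbh G U)"
proof -
  obtain D where D: "finite_cut G D" "tail_in R D" "D \<inter> U = {}" using far far_iff[OF R] by blast
  obtain E where E: "\<And>v. v \<in> verts G \<Longrightarrow> finite_cut G (E v) \<and> tail_in R (E v) \<and> v \<notin> E v \<union> nbh G (E v)"
    using undom by metis
  let ?D = "D \<inter> (\<Inter>v\<in>nbh G D. E v)"
  have X: "nbh G D \<subseteq> verts G" "finite (nbh G D)" using D by (auto simp: nbh_def finite_cut_def)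
  have "finite_cut G ?D" using X E by (intro cut_INT[OF graph] D) auto
  moreover have "tail_in R ?D" using X E by (intro tail_in_Int tail_in_INT D) auto
  moreover have "y \<notin> U \<union> nbh G U" if y: "y \<in> ?D" for y
  proof
    assume "y \<in> U \<union> nbh G U"
    then obtain u where u: "u \<in> U" "adj G u y" "y \<in> verts G" using D(3) y by (auto simp: nbh_def)
    then have uv: "u \<in> verts G" "adj G y u" using adj_verts[OF graph] adj_sym[OF graph] by blast+
    then have "u \<in> nbh G D" using y u D(3) by (auto simp: nbh_def)
    then have "y \<in> E u" using y by blast
    then show False using E[OF uv(1)] uv by (auto simp: nbh_def)
  qed
  ultimately show ?thesis unfolding far_iff[OF R] by (intro exI[of _ ?D]) blast
qed

text \<open>The star-comb lemma in terms of cuts; \<open>f\<close> need not be injective, so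
  infinitely many indices may sit at one vertex. In a breadth-first spanning tree of
  \<open>C\<close>, either some vertex has infinitely many indices below it but only finitely many
  below each child (the centre of a star), or one can descend forever through vertices with
  infinitely many indices below them (the spine of a comb).\<close>

lemma star_comb:
  assumes C: "C \<subseteq> verts G" "c0 \<in> C" "\<And>x. x \<in> C \<Longrightarrow> conn G C c0 x"
    and f: "f ` W \<subseteq> C" and W: "infinite W"
  shows "(\<exists>c\<in>C. \<forall>D. finite_cut G D \<longrightarrow> c \<in> D \<longrightarrow> infinite {w \<in> W. f w \<in> D}) \<or>
    (\<exists>R. ray G R \<and> range R \<subseteq> C \<and> (\<forall>D. finite_cut G D \<longrightarrow> tail_in R D \<longrightarrow> infinite {w \<in> W. f w \<in> D}))"
proof -
  \<comment> \<open>\<open>L n\<close> holds the endpoints of walks of length n in \<open>C\<close>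
    from \<open>c0\<close>; the least such n, called \<open>d\<close> below, is the distance from
    \<open>c0\<close> in \<open>C\<close>.\<close>
  define L where "L = rec_nat {c0} (\<lambda>_ L. {y \<in> C. \<exists>x\<in>L. adj G x y})"
  have L: "L 0 = {c0}" "\<And>n. L (Suc n) = {y \<in> C. \<exists>x\<in>L n. adj G x y}" by (simp_all add: L_def)
  have LC: "L n \<subseteq> C" for n by (cases n) (use L C in auto)
  have exL: "\<exists>n. x \<in> L n" if "conn G C c x" "c = c0" for c x
    using that
  proof (induction rule: conn.induct)
    case (conn_refl x)
    then show ?case using L(1) by blast
  next
    case (conn_step x y z)
    then show ?case using L(2) by blast
  qed
  define d where "d x = (LEAST n. x \<in> L n)" for x
  have dL: "x \<in> L (d x)" if "x \<in> C" for x
    unfolding d_def using exL[OF C(3)[OF that]] by (auto intro: LeastI_ex)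
  have d_le: "d x \<le> n" if "x \<in> L n" for x n
    unfolding d_def using that by (rule Least_le)
  have "\<exists>x. x \<in> C \<and> adj G x y \<and> d y = Suc (d x)" if y: "y \<in> C" "y \<noteq> c0" for y
  proof -
    obtain n where n: "d y = Suc n" using dL[OF y(1)] y(2) L(1) by (cases "d y") auto
    then obtain x where x: "x \<in> L n" "adj G x y" using dL[OF y(1)] L(2) by auto
    have "y \<in> L (Suc (d x))" using x y L(2) dL LC by blast
    then have "d x = n" using d_le[OF x(1)] d_le[of y "Suc (d x)"] n by simp
    then show ?thesis using x n LC by blast
  qed
  then obtain par where par: "\<And>y. y \<in> C \<Longrightarrow> y \<noteq> c0 \<Longrightarrow> par y \<in> C \<and> adj G (par y) y \<and> d y = Suc (d (par y))"
    by metis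
  have dc0: "d c0 = 0" using d_le[of c0 0] L(1) by simp
  \<comment> \<open>For n at most \<open>d z\<close>, this is the ancestor of z on level n of the
    tree.\<close>
  define anc where "anc z n = (par ^^ (d z - n)) z" for z n
  have anc_self: "anc z (d z) = z" for z by (simp add: anc_def)
  have anc_step: "anc z n = anc (par z) n" if "z \<in> C" "n < d z" for z n
  proof -
    have "z \<noteq> c0" using that dc0 by auto
    then have "d z - n = Suc (d (par z) - n)" using par[OF that(1)] that(2) by simp
    then show ?thesis by (simp only: anc_def funpow_Suc_right o_apply)
  qed
  have anc_Suc: "anc z n = par (anc z (Suc n)) \<and> d (anc z n) = n \<and> anc z n \<in> C"
    if "z \<in> C" "n < d z" for z n
    using that
  proof (induction "d z" arbitrary: z)
    case (Suc k)
    have z: "z \<noteq> c0" using Suc dc0 by auto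
    then have p: "par z \<in> C" "d (par z) = k" using par Suc by auto
    show ?case
    proof (cases "n = k")
      case True
      have "anc z (Suc n) = z" using anc_self[of z] True Suc by simp
      moreover have "anc z n = par z" using anc_step[of z n] anc_self[of "par z"] True Suc p by simp
      ultimately show ?thesis using p True by simp
    next
      case False
      then have "n < d (par z)" "Suc n < d z" using p Suc by auto
      then show ?thesis using Suc(1)[of "par z"] p anc_step[of z] Suc by simp
    qed
  qed simp
  define below where "below x = {z \<in> C. d x \<le> d z \<and> anc z (d x) = x}" for x
  define child where "child x y \<longleftrightarrow> y \<in> C \<and> y \<noteq> c0 \<and> par y = x" for x y
  have conn_below: "conn G (below x) z x" if "z \<in> below x" for x z
    using that
  proof (induction "d z" arbitrary: z rule: less_induct)
    case less
    show ?case
    proof (cases "d z = d x")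
      case True
      then have "z = x" using less anc_self[of z] by (simp add: below_def)
      then show ?thesis using less by (auto intro: conn_refl)
    next
      case False
      then have z: "z \<in> C" "d x < d z" "z \<noteq> c0" "anc z (d x) = x" using less(2) dc0 by (auto simp: below_def)
      then have p: "par z \<in> below x" "d (par z) < d z"
        using par[of z] anc_step[of z "d x"] by (auto simp: below_def)
      have "conn G (below x) z (par z)"
        using par[of z] z less(2) p adj_sym[OF graph] by (intro conn_edge) auto
      then show ?thesis using less(1)[OF p(2,1)] conn_trans by metis
    qed
  qed
  have below_split: "z = x \<or> (\<exists>y. child x y \<and> z \<in> below y \<and> y = anc z (Suc (d x)))" if "z \<in> below x" for x z
  proof (cases "d z = d x")
    case True
    then show ?thesis using that anc_self[of z] by (simp add: below_def)
  next
    case False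
    let ?y = "anc z (Suc (d x))"
    have z: "z \<in> C" "d x < d z" "anc z (d x) = x" using that False by (auto simp: below_def)
    have y: "?y \<in> C" "d ?y = Suc (d x)"
    proof -
      have "?y \<in> C \<and> d ?y = Suc (d x)"
      proof (cases "Suc (d x) = d z")
        case True
        then show ?thesis using anc_self[of z] z by simp
      next
        case False
        then show ?thesis using anc_Suc[of z "Suc (d x)"] z by linarith
      qed
      then show "?y \<in> C" "d ?y = Suc (d x)" by auto
    qed
    have "child x ?y" using y dc0 anc_Suc[of z "d x"] z by (auto simp: child_def)
    moreover have "z \<in> below ?y" using z y by (simp add: below_def)
    ultimately show ?thesis by blast
  qed
  define I where "I x = {w \<in> W. f w \<in> below x}" for x
  have below_c0: "below c0 = C"
  proof -
    have "anc z 0 = c0" if "z \<in> C" for z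
    proof (cases "d z")
      case 0
      then show ?thesis using anc_self[of z] dL[OF that] L by simp
    next
      case (Suc n)
      then have "d (anc z 0) = 0" "anc z 0 \<in> C" using anc_Suc[of z 0] that by auto
      then show ?thesis using dL[of "anc z 0"] L by simp
    qed
    then show ?thesis by (auto simp: below_def dc0)
  qed
  have I0: "infinite (I c0)"
  proof -
    have "I c0 = W" using f by (auto simp: I_def below_c0)
    then show ?thesis using W by simp
  qed
  show ?thesis
  proof (cases "\<exists>x\<in>C. infinite (I x) \<and> (\<forall>y. child x y \<longrightarrow> finite (I y))")
    case True
    then obtain x where x: "x \<in> C" "infinite (I x)" "\<And>y. child x y \<Longrightarrow> finite (I y)" by blast
    have "infinite {w \<in> W. f w \<in> D}" if D: "finite_cut G D" "x \<in> D" for D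
    proof -
      \<comment> \<open>Distinct children have disjoint subtrees, so only finitely many subtrees
        meet the finite neighbourhood of \<open>D\<close>. Every other child is adjacent to x in
        \<open>D\<close>, hence lies in \<open>D\<close> together with its whole subtree.\<close>
      define B where "B = {y. child x y \<and> below y \<inter> nbh G D \<noteq> {}}"
      have "B \<subseteq> (\<lambda>z. anc z (Suc (d x))) ` nbh G D"
      proof
        fix y assume "y \<in> B"
        then obtain z where "child x y" "z \<in> below y" "z \<in> nbh G D" by (auto simp: B_def)
        then show "y \<in> (\<lambda>z. anc z (Suc (d x))) ` nbh G D"
          using par[of y] by (intro image_eqI[of _ _ z]) (auto simp: child_def below_def)
      qed
      then have "finite B" using D(1) by (auto simp: finite_cut_def intro: finite_subset)
      then have "finite (\<Union>y\<in>B. I y)" using x(3) by (auto simp: B_def)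
      then have "infinite (I x - (\<Union>y\<in>B. I y))" using x(2) by simp
      moreover have "I x - (\<Union>y\<in>B. I y) \<subseteq> {w \<in> W. f w \<in> D}"
      proof
        fix w assume w: "w \<in> I x - (\<Union>y\<in>B. I y)"
        then have wW: "w \<in> W" "f w \<in> below x" by (auto simp: I_def)
        show "w \<in> {w \<in> W. f w \<in> D}"
        proof (cases "f w = x")
          case False
          then obtain y where y: "child x y" "f w \<in> below y" using below_split[OF wW(2)] by blast
          then have "below y \<inter> nbh G D = {}" using w wW by (auto simp: B_def I_def)
          moreover have c: "conn G (below y) y (f w)" using conn_below[OF y(2)] by (rule conn_sym)
          moreover have "y \<in> D"
          proof -
            have "adj G x y" "y \<in> verts G" using y(1) par[of y] C(1) by (auto simp: child_def)
            moreover have "y \<in> below y" using conn_in[OF c] by blast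
            then have "y \<notin> nbh G D" using \<open>below y \<inter> nbh G D = {}\<close> by blast
            ultimately show ?thesis using D(2) by (auto simp: nbh_def)
          qed
          ultimately have "f w \<in> D" using conn_stays[OF graph] by blast
          then show ?thesis using wW by simp
        qed (use D wW in auto)
      qed
      ultimately show ?thesis using finite_subset by blast
    qed
    then show ?thesis using x(1) by blast
  next
    case False
    then obtain nxt where nxt: "\<And>x. x \<in> C \<Longrightarrow> infinite (I x) \<Longrightarrow> child x (nxt x) \<and> infinite (I (nxt x))"
      by metis
    define R where "R n = (nxt ^^ n) c0" for n
    have R: "R n \<in> C \<and> infinite (I (R n)) \<and> d (R n) = n" for n
    proof (induction n)
      case 0
      then show ?case using C(2) I0 dc0 by (simp add: R_def)
    next
      case (Suc n)
      then have "child (R n) (R (Suc n)) \<and> infinite (I (R (Suc n)))"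
        using nxt by (simp add: R_def)
      then show ?case using par[of "R (Suc n)"] Suc by (auto simp: child_def)
    qed
    have ray: "ray G R"
      unfolding ray_def
    proof (intro conjI allI)
      show "inj R" by (rule injI) (metis R)
      show "range R \<subseteq> verts G" using R C by blast
      fix i
      have "child (R i) (R (Suc i))" using nxt R by (simp add: R_def)
      then show "adj G (R i) (R (Suc i))" using par[of "R (Suc i)"] by (auto simp: child_def)
    qed
    have "infinite {w \<in> W. f w \<in> D}" if D: "finite_cut G D" "tail_in R D" for D
    proof -
      obtain m where m: "\<forall>i\<ge>m. R i \<in> D" using D(2) by (auto simp: tail_in_def)
      \<comment> \<open>Beyond depth \<open>k\<close> the tree misses \<open>nbh G D\<close>, so the
        subtree below a deep enough vertex of R lies entirely in \<open>D\<close>.\<close>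
      obtain k where k: "\<forall>n\<in>d ` nbh G D. n < k"
        using D(1) finite_nat_set_iff_bounded[of "d ` nbh G D"] by (auto simp: finite_cut_def)
      let ?x = "R (max m k)"
      have disj: "below ?x \<inter> nbh G D = {}" using k R[of "max m k"] by (fastforce simp: below_def)
      have "below ?x \<subseteq> D"
        using conn_stays[OF graph conn_sym[OF conn_below], of _ ?x D] disj m by auto
      then have "I ?x \<subseteq> {w \<in> W. f w \<in> D}" by (auto simp: I_def)
      then show ?thesis using R finite_subset by blast
    qed
    then show ?thesis using ray R by blast
  qed
qed

end


section \<open>Components and envelopes\<close>

definition comps :: "'a ugraph \<Rightarrow> 'a set \<Rightarrow> 'a set set" where
  "comps G A = (\<lambda>x. {y. conn G A x y}) ` A"

lemma comps_sub: "D \<in> comps G A \<Longrightarrow> D \<subseteq> A \<and> D \<noteq> {}"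
  using conn_in conn_refl by (fastforce simp: comps_def)

lemma comps_eq: "D \<in> comps G A \<Longrightarrow> x \<in> D \<Longrightarrow> D = {y. conn G A x y}"
  by (auto simp: comps_def) (meson conn_sym conn_trans)+

text \<open>A walk in \<open>A\<close> starting in the component never leaves it, so it witnesses
  connectedness inside the component itself.\<close>

lemma comps_conn: "D \<in> comps G A \<Longrightarrow> x \<in> D \<Longrightarrow> y \<in> D \<Longrightarrow> conn G D x y"
proof -
  assume D: "D \<in> comps G A" "x \<in> D" "y \<in> D"
  have D': "D = {y. conn G A x y}" by (rule comps_eq[OF D(1,2)])
  have "conn G A x y" using D D' by blast
  then have "conn G {y. conn G A x y} x y"
  proof (induction rule: conn.induct)
    case (conn_step x y z)
    then have "conn G A x z" by (meson conn.conn_step)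
    then show ?case using conn_step by (metis (mono_tags) conn.conn_step mem_Collect_eq)
  qed (auto intro: conn.intros)
  then show ?thesis using D' by simp
qed

context
  fixes G :: "'a ugraph"
  assumes graph: "graph G"
begin

lemma nbh_comps: "D \<in> comps G (verts G - X) \<Longrightarrow> nbh G D \<subseteq> X"
  using nbh_comp[OF graph, of X] by (fastforce simp: comps_def)

text \<open>
  First a maximal family of disjoint rays converging to \<open>U\<close> is added to \<open>U\<close>, then all vertices
  that no finite set separates from the result. An infinite neighbourhood of a remaining
  component would yield, by the star-comb lemma, a further vertex or ray of this kind.
\<close>

theorem envelope:
  assumes U: "U \<subseteq> verts G"
  shows "\<exists>E. U \<subseteq> E \<and> E \<subseteq> verts G \<and> (\<forall>R. ray G R \<longrightarrow> far G R U \<longrightarrow> far G R E) \<and>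
    (\<forall>C\<in>comps G (verts G - E). finite (nbh G C))"
proof -
  define \<A> where "\<A> = {\<R>. (\<forall>R\<in>\<R>. ray G R \<and> \<not> far G R U) \<and>
    (\<forall>R\<in>\<R>. \<forall>S\<in>\<R>. R \<noteq> S \<longrightarrow> range R \<inter> range S = {})}"
  have "\<exists>M\<in>\<A>. \<forall>F\<in>\<A>. M \<subseteq> F \<longrightarrow> F = M"
  proof (rule subset_Zorn')
    fix \<C> assume "subset.chain \<A> \<C>"
    then have C: "\<C> \<subseteq> \<A>" "\<And>F F'. F \<in> \<C> \<Longrightarrow> F' \<in> \<C> \<Longrightarrow> F \<subseteq> F' \<or> F' \<subseteq> F"
      by (auto simp: subset_chain_def)
    have "range R \<inter> range S = {}" if RS: "R \<in> F" "F \<in> \<C>" "S \<in> F'" "F' \<in> \<C>" "R \<noteq> S" for R S F F'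
    proof -
      obtain H where "H \<in> \<C>" "R \<in> H" "S \<in> H" using C(2)[of F F'] RS by blast
      moreover have "H \<in> \<A>" using C(1) \<open>H \<in> \<C>\<close> by blast
      ultimately show ?thesis using RS(5) by (simp add: \<A>_def)
    qed
    moreover have "ray G R \<and> \<not> far G R U" if "R \<in> F" "F \<in> \<C>" for R F
      using that C(1) by (auto simp: \<A>_def)
    ultimately show "\<Union>\<C> \<in> \<A>" unfolding \<A>_def by blast
  qed
  then obtain \<R> where \<R>: "\<R> \<in> \<A>" and max: "\<And>\<S>. \<S> \<in> \<A> \<Longrightarrow> \<R> \<subseteq> \<S> \<Longrightarrow> \<S> = \<R>" by blast
  have \<R>_ray: "ray G R" "\<not> far G R U" if "R \<in> \<R>" for R using \<R> that by (auto simp: \<A>_def)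
  have \<R>_disj: "R = S" if "R \<in> \<R>" "S \<in> \<R>" "x \<in> range R" "x \<in> range S" for R S x
    using \<R> that unfolding \<A>_def by blast
  define U' where "U' = U \<union> (\<Union>R\<in>\<R>. range R)"
  have U': "U \<subseteq> U'" "U' \<subseteq> verts G" using U \<R>_ray(1) by (auto simp: U'_def ray_def)
  have far': "far G R U'" if R: "ray G R" "far G R U" for R
  proof -
    obtain D where D: "finite_cut G D" "tail_in R D" "D \<inter> U = {}" using R far_iff[OF graph] by blast
    define \<S> where "\<S> = {S \<in> \<R>. range S \<inter> D \<noteq> {}}"
    have ntail: "\<not> tail_in S D" if "S \<in> \<R>" for S
      using \<R>_ray[OF that] far_iff[OF graph] D by blast
    \<comment> \<open>A ray of the family is not far from \<open>U\<close>, so it has no tail in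
      \<open>D\<close>; having met \<open>D\<close>, it must leave through the neighbourhood. The
      rays are disjoint and the neighbourhood is finite, so only finitely many of them meet
      \<open>D\<close>, each in finitely many vertices.\<close>
    have "\<exists>x. x \<in> range S \<inter> nbh G D" if S: "S \<in> \<S>" for S
    proof (rule ccontr)
      assume no: "\<nexists>x. x \<in> range S \<inter> nbh G D"
      obtain i where i: "S i \<in> D" using S by (auto simp: \<S>_def)
      have "S j \<in> D" if "j \<ge> i" for j
        using ray_stays[where G = G and R = S and m = i and D = D and i = j] graph i
          \<R>_ray S no that by (auto simp: \<S>_def)
      then have "tail_in S D" by (auto simp: tail_in_def)
      then show False using ntail S by (auto simp: \<S>_def)
    qed
    then obtain g where g: "\<And>S. S \<in> \<S> \<Longrightarrow> g S \<in> range S \<inter> nbh G D" by metis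
    have "inj_on g \<S>"
    proof (rule inj_onI)
      fix S S' assume "S \<in> \<S>" "S' \<in> \<S>" "g S = g S'"
      then show "S = S'" using \<R>_disj[of S S' "g S"] g[of S] g[of S'] by (auto simp: \<S>_def)
    qed
    moreover have "finite (g ` \<S>)"
      using g D(1) by (intro finite_subset[of "g ` \<S>" "nbh G D"]) (auto simp: finite_cut_def)
    ultimately have "finite \<S>" using finite_image_iff by blast
    moreover have "finite (range S \<inter> D)" if "S \<in> \<S>" for S
    proof -
      have "S \<in> \<R>" using that by (simp add: \<S>_def)
      then have "tail_in S (verts G - D)"
        using tail_in_outside_iff[OF graph \<R>_ray(1) D(1)] ntail by blast
      then obtain m where "\<forall>i\<ge>m. S i \<notin> D" by (auto simp: tail_in_def)
      then have "range S \<inter> D \<subseteq> S ` {..<m}" using not_le by (auto simp: image_iff)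
      then show ?thesis by (rule finite_subset) simp
    qed
    ultimately have "finite (\<Union>S\<in>\<S>. range S \<inter> D)" by blast
    moreover have "D \<inter> U' \<subseteq> (\<Union>S\<in>\<S>. range S \<inter> D)" using D(3) by (auto simp: U'_def \<S>_def)
    ultimately show ?thesis using D finite_subset unfolding far_def by blast
  qed
  \<comment> \<open>Closing \<open>U'\<close> under vertices that no finite cut separates from it: a
    finite cut that avoids \<open>U'\<close> then avoids \<open>E\<close> as well.\<close>
  define E where "E = {v \<in> verts G. \<forall>D. finite_cut G D \<longrightarrow> v \<in> D \<longrightarrow> D \<inter> U' \<noteq> {}}"
  have E: "U' \<subseteq> E" "E \<subseteq> verts G" using U' by (auto simp: E_def)
  have cutE: "D \<inter> E = {}" if "finite_cut G D" "D \<inter> U' = {}" for D using that by (auto simp: E_def)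
  have farE: "far G R E" if R: "ray G R" "far G R U" for R
  proof -
    obtain D where "finite_cut G D" "tail_in R D" "D \<inter> U' = {}"
      using far'[OF R] far_iff[OF graph R(1)] by blast
    then show ?thesis using far_iff[OF graph R(1)] cutE by blast
  qed
  have finE: "finite (nbh G C)" if C: "C \<in> comps G (verts G - E)" for C
  proof (rule ccontr)
    assume inf: "infinite (nbh G C)"
    have CE: "C \<subseteq> verts G - E" "C \<noteq> {}" using comps_sub[OF C] by auto
    then obtain c0 where c0: "c0 \<in> C" by blast
    have NE: "nbh G C \<subseteq> E" using nbh_comps[OF C] .
    have "\<forall>w\<in>nbh G C. \<exists>u\<in>C. adj G u w" by (auto simp: nbh_def)
    then obtain f where f: "\<And>w. w \<in> nbh G C \<Longrightarrow> f w \<in> C \<and> adj G (f w) w" by metis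
    \<comment> \<open>Neighbours of \<open>C\<close> lie in \<open>E\<close>, hence outside
      \<open>D\<close>; so a neighbour attached to \<open>C\<close> at a vertex of \<open>D\<close>
      belongs to the finite set \<open>nbh G D\<close>. Both outcomes of the star-comb lemma will
      contradict this.\<close>
    have fin: "finite {w \<in> nbh G C. f w \<in> D}" if D: "finite_cut G D" "D \<inter> E = {}" for D
    proof -
      have "{w \<in> nbh G C. f w \<in> D} \<subseteq> nbh G D"
        using f NE D E(2) by (force simp: nbh_def[of _ D])
      then show ?thesis using D finite_subset by (auto simp: finite_cut_def)
    qed
    from star_comb[OF graph _ c0 comps_conn[OF C c0] _ inf, of f] f CE
    consider c where "c \<in> C" "\<And>D. finite_cut G D \<Longrightarrow> c \<in> D \<Longrightarrow> infinite {w \<in> nbh G C. f w \<in> D}"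
      | R where "ray G R" "range R \<subseteq> C" "\<And>D. finite_cut G D \<Longrightarrow> tail_in R D \<Longrightarrow> infinite {w \<in> nbh G C. f w \<in> D}"
      by blast
    then show False
    proof cases
      case 1
      then have "c \<in> verts G" "c \<notin> E" using CE by auto
      then obtain D where "finite_cut G D" "c \<in> D" "D \<inter> U' = {}" by (auto simp: E_def)
      then show False using 1(2) fin cutE by blast
    next
      case 2
      \<comment> \<open>The comb yields a ray that is not far from \<open>U\<close> and is disjoint
        from every ray of the family, contradicting maximality.\<close>
      have "\<not> far G R U"
      proof
        assume "far G R U"
        then obtain D where "finite_cut G D" "tail_in R D" "D \<inter> E = {}"
          using farE[OF 2(1)] far_iff[OF graph 2(1)] by blast
        then show False using 2(3) fin by blast
      qed
      moreover have disj: "range R \<inter> U' = {}" using 2(2) CE E(1) by blast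
      moreover have "range R \<inter> range S = {}" if "S \<in> \<R>" for S using disj that by (auto simp: U'_def)
      ultimately have "insert R \<R> \<in> \<A>" using \<R> 2(1) by (auto simp: \<A>_def Int_commute)
      then have "R \<in> \<R>" using max[of "insert R \<R>"] by blast
      then show False using disj by (auto simp: U'_def)
    qed
  qed
  show ?thesis
    using U'(1) E(1) by (intro exI[of _ E] conjI allI impI ballI farE finE E(2)) auto
qed

section \<open>Exhaustion by envelopes\<close>

definition undominated :: "(nat \<Rightarrow> 'a) \<Rightarrow> bool" where
  "undominated R \<longleftrightarrow> ray G R \<and> (\<forall>v\<in>verts G. \<exists>D. finite_cut G D \<and> tail_in R D \<and> v \<notin> D \<union> nbh G D)"

lemma topological_end_iff:
  assumes "\<omega> \<in> vertex_ends G" "R \<in> \<omega>"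
  shows "\<omega> \<in> topological_ends G \<longleftrightarrow> undominated R"
  using dominates_iff[OF graph assms] vertex_end_class(1)[OF graph assms] assms(1)
  unfolding topological_ends_def undominated_def by blast

text \<open>\<open>U 0\<close> is an envelope of one vertex from each component of G, and each later
  set is an envelope of its predecessor with its neighbourhood. Every vertex is reached after
  finitely many steps because it has finite distance from its chosen representative.\<close>

lemma exhaustion_exists:
  shows "\<exists>U. (\<forall>n. U n \<subseteq> verts G) \<and> (\<forall>n. U n \<union> nbh G (U n) \<subseteq> U (Suc n)) \<and> (\<Union>n. U n) = verts G \<and>
    (\<forall>n. \<forall>C\<in>comps G (verts G - U n). finite (nbh G C)) \<and>
    (\<forall>n R. undominated R \<longrightarrow> far G R (U n))"
proof -
  obtain env where env: "\<And>U. U \<subseteq> verts G \<Longrightarrow> U \<subseteq> env U \<and> env U \<subseteq> verts G \<and>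
    (\<forall>R. ray G R \<longrightarrow> far G R U \<longrightarrow> far G R (env U)) \<and>
    (\<forall>C\<in>comps G (verts G - env U). finite (nbh G C))"
    using envelope by metis
  define A where "A = (\<lambda>D. SOME x. x \<in> D) ` comps G (verts G)"
  have some: "(SOME x. x \<in> D) \<in> D" if "D \<in> comps G (verts G)" for D
    using comps_sub[OF that] by (auto intro: someI)
  have AV: "A \<subseteq> verts G" using some comps_sub by (fastforce simp: A_def)
  define U where "U = rec_nat (env A) (\<lambda>_ U. env (U \<union> nbh G U))"
  have U: "U 0 = env A" "\<And>n. U (Suc n) = env (U n \<union> nbh G (U n))" by (simp_all add: U_def)
  have nV: "nbh G X \<subseteq> verts G" for X by (auto simp: nbh_def)
  have UV: "U n \<subseteq> verts G" for n
  proof (induction n)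
    case 0
    then show ?case using env[OF AV] U by simp
  next
    case (Suc n)
    then show ?case using env[of "U n \<union> nbh G (U n)"] nV U by simp
  qed
  then have V: "U n \<union> nbh G (U n) \<subseteq> verts G" for n using nV by simp
  have step: "U n \<union> nbh G (U n) \<subseteq> U (Suc n)" for n using env[OF V] U by simp
  have fin: "\<forall>C\<in>comps G (verts G - U n). finite (nbh G C)" for n
    by (cases n) (use env[OF AV] env[OF V] U in auto)
  have far: "far G R (U n)" if R: "undominated R" for R n
  proof (induction n)
    case 0
    \<comment> \<open>A whole component of G is a finite cut with empty neighbourhood, and it meets
      \<open>A\<close> only in its representative.\<close>
    let ?D = "{y. conn G (verts G) (R 0) y}"
    have r: "ray G R" using R by (simp add: undominated_def)
    then have "R 0 \<in> verts G" by (auto simp: ray_def)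
    then have D: "?D \<in> comps G (verts G)" by (auto simp: comps_def)
    have "finite_cut G ?D" using cut_comp[OF graph, of "{}"] by simp
    moreover have "tail_in R ?D"
      using conn_tail[where G = G and R = R and m = 0 and A = "verts G"] r by (auto simp: ray_def tail_in_def intro!: exI[of _ 0])
    moreover have "?D \<inter> A \<subseteq> {SOME x. x \<in> ?D}"
    proof
      fix x assume "x \<in> ?D \<inter> A"
      then obtain D' where D': "D' \<in> comps G (verts G)" "x = (SOME x. x \<in> D')" "x \<in> ?D"
        by (auto simp: A_def)
      then have "x \<in> D'" using some by simp
      then have "D' = ?D" using comps_eq[OF D'(1)] comps_eq[OF D D'(3)] by simp
      then show "x \<in> {SOME x. x \<in> ?D}" using D' by simp
    qed
    then have "finite (?D \<inter> A)" by (rule finite_subset) simp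
    ultimately have "far G R A" unfolding far_def by blast
    then show ?case using env[OF AV] r U by simp
  next
    case (Suc n)
    then have "far G R (U n \<union> nbh G (U n))"
      using R by (intro far_nbh[OF graph]) (auto simp: undominated_def)
    then show ?case using env[OF V] R U by (simp add: undominated_def)
  qed
  have "v \<in> (\<Union>n. U n)" if v: "v \<in> verts G" for v
  proof -
    let ?D = "{y. conn G (verts G) v y}"
    have D: "?D \<in> comps G (verts G)" using v by (auto simp: comps_def)
    define a where "a = (SOME x. x \<in> ?D)"
    have "a \<in> U 0" using D env[OF AV] U by (auto simp: A_def a_def)
    moreover have "conn G (verts G) a v" using some[OF D] by (auto simp: a_def intro: conn_sym)
    then have "a \<in> U 0 \<Longrightarrow> \<exists>n. v \<in> U n"
    proof (induction rule: conn.induct)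
      case (conn_step x y z)
      then obtain n where "y \<in> U n" by blast
      then have "z \<in> U n \<union> nbh G (U n)" using conn_step by (auto simp: nbh_def)
      then show ?case using step by blast
    qed blast
    ultimately show ?thesis by blast
  qed
  then have "(\<Union>n. U n) = verts G" using UV by blast
  then show ?thesis
    by (intro exI[of _ U] conjI allI impI UV step far fin) auto
qed

end


section \<open>Trees of nested components\<close>

text \<open>Entering and leaving \<open>A\<close> would both use the single attaching vertex
  \<open>a\<close>, which a path cannot visit twice. The first and the last visit to
  \<open>A\<close> are compared.\<close>

lemma path_avoids:
  assumes "path_between T t p w" "t \<notin> A" "w \<notin> A"
    and att: "\<And>x y. adj T x y \<Longrightarrow> x \<in> A \<Longrightarrow> y \<notin> A \<Longrightarrow> y = a"
  shows "set p \<inter> A = {}"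
proof (rule ccontr)
  assume "set p \<inter> A \<noteq> {}"
  then have "\<exists>z\<in>set p. z \<in> A" by blast
  then obtain as z bs where 1: "p = as @ z # bs" "z \<in> A" "\<forall>y\<in>set as. y \<notin> A"
    using split_list_first_prop[of p "\<lambda>z. z \<in> A"] by blast
  then have "\<exists>z\<in>set (z # bs). z \<in> A" by auto
  then obtain cs z' ds where 2: "z # bs = cs @ z' # ds" "z' \<in> A" "\<forall>y\<in>set ds. y \<notin> A"
    using split_list_last_prop[of "z # bs" "\<lambda>z. z \<in> A"] by blast
  have p: "p = as @ cs @ z' # ds" using 1 2 by simp
  have suc: "successively (adj T) p" "distinct p" "hd p = t" "last p = w"
    using assms(1) by (auto simp: path_between_def path_def)
  have "as \<noteq> []" using 1 suc assms(2) by (cases as) auto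
  then have as: "last as \<in> set as" "adj T (last as) z"
    using suc(1) 1(1) by (auto simp: successively_append_iff)
  have "ds \<noteq> []" using p suc assms(3) 2(2) by auto
  then have ds: "hd ds \<in> set ds" "adj T z' (hd ds)"
    using suc(1) p by (auto simp: successively_append_iff successively_Cons)
  have "last as = a" using att[of z "last as"] as 1 by (simp add: insert_commute)
  moreover have "hd ds = a" using att[of z' "hd ds"] ds 2 by simp
  ultimately show False using as ds suc(2) p by auto
qed

lemma graph_del_edge: "graph T \<Longrightarrow> graph (del_edge T e)"
  by (auto simp: graph_def del_edge_def)

lemma conn_del_edge: "conn T A x y \<Longrightarrow> \<not> e \<subseteq> A \<Longrightarrow> conn (del_edge T e) A x y"
proof (induction rule: conn.induct)
  case (conn_step x y z)
  have "y \<in> A" using conn_in[OF conn_step(1)] by simp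
  then have "{y, z} \<noteq> e" using conn_step by blast
  then have "adj (del_edge T e) y z" using conn_step by (simp add: del_edge_def)
  then show ?case using conn.conn_step[OF conn_step(4)] conn_step by blast
qed (auto intro: conn.intros)

definition region :: "'a ugraph \<Rightarrow> 'a node \<Rightarrow> 'a set" where
  "region G xs = (case xs of [] \<Rightarrow> verts G | D # _ \<Rightarrow> D)"

lemma region_simps [simp]: "region G [] = verts G" "region G (D # xs) = D"
  by (simp_all add: region_def)

locale exhaustion =
  fixes G :: "'a ugraph" and U :: "nat \<Rightarrow> 'a set"
  assumes graph: "graph G"
    and U_verts: "U n \<subseteq> verts G"
    and U_step: "U n \<union> nbh G (U n) \<subseteq> U (Suc n)"
    and U_cover: "(\<Union>n. U n) = verts G"
    and U_adhesion: "C \<in> comps G (verts G - U n) \<Longrightarrow> finite (nbh G C)"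
    and U_far: "undominated G R \<Longrightarrow> far G R (U n)"
begin

text \<open>A node is the list of the components \<open>D\<^sub>n \<subseteq> \<dots> \<subseteq> D\<^sub>0\<close>, with \<open>D\<^sub>i\<close> a component of \<open>G - U i\<close>.\<close>

inductive node :: "'a node \<Rightarrow> bool" where
  node_Nil: "node []"
| node_Cons: "node xs \<Longrightarrow> D \<in> comps G (verts G - U (length xs)) \<Longrightarrow> D \<subseteq> region G xs \<Longrightarrow> node (D # xs)"

inductive_cases node_ConsE: "node (D # xs)"

definition T :: "'a node ugraph" where
  "T = \<lparr>verts = Collect node, edges = {{xs, D # xs} | xs D. node (D # xs)}\<rparr>"

definition below :: "'a node \<Rightarrow> 'a node set" where
  "below u = {x. node x \<and> suffix u x}"

text \<open>The first summand is the adhesion set towards the parent; the second holds the vertices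
  of the region that \<open>U\<close> has absorbed by this level.\<close>

definition part :: "'a node \<Rightarrow> 'a set" where
  "part xs = nbh G (region G xs) \<union> (region G xs \<inter> U (length xs))"

definition P :: "'a node \<Rightarrow> 'a ugraph" where
  "P xs = \<lparr>verts = part xs, edges = {e \<in> edges G. e \<subseteq> part xs}\<rparr>"

definition lvl :: "'a \<Rightarrow> nat" where
  "lvl v = (LEAST n. v \<in> U n)"

text \<open>For n at most \<open>lvl v\<close>, this is the node of length n whose region contains
  v.\<close>

primrec branch :: "'a \<Rightarrow> nat \<Rightarrow> 'a node" where
  "branch v 0 = []"
| "branch v (Suc n) = {y. conn G (verts G - U n) v y} # branch v n"

section \<open>Levels, regions and parts\<close>

lemma U_mono: "n \<le> m \<Longrightarrow> U n \<subseteq> U m"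
  using lift_Suc_mono_le[of U] U_step by blast

lemma in_U_iff: "v \<in> verts G \<Longrightarrow> v \<in> U n \<longleftrightarrow> lvl v \<le> n"
proof
  assume "v \<in> verts G" "lvl v \<le> n"
  moreover then have "v \<in> U (lvl v)" using U_cover unfolding lvl_def by (metis LeastI UN_E)
  ultimately show "v \<in> U n" using U_mono by blast
qed (simp add: lvl_def Least_le)

lemma node_tl: "node (D # xs) \<Longrightarrow> node xs"
  by (auto elim: node_ConsE)

lemma node_suffix: "suffix u x \<Longrightarrow> node x \<Longrightarrow> node u \<and> region G x \<subseteq> region G u"
proof (induction x)
  case (Cons D x)
  then show ?case
    by (cases "u = D # x") (auto simp: suffix_Cons elim!: node_ConsE)
qed auto

lemma region_verts: "node xs \<Longrightarrow> region G xs \<subseteq> verts G"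
  using node_suffix[of "[]" xs] by simp

text \<open>A component is determined by any of its vertices, so a node is determined by its length
  and one vertex of its region. That region avoids the earlier sets \<open>U\<close>, which bounds
  the length.\<close>

lemma node_branch:
  "node xs \<Longrightarrow> v \<in> region G xs \<Longrightarrow> xs = branch v (length xs) \<and> length xs \<le> lvl v"
proof (induction rule: node.induct)
  case (node_Cons xs D)
  then have "v \<in> verts G - U (length xs)" using comps_sub by fastforce
  then have "length xs < lvl v" using in_U_iff by fastforce
  then show ?case using node_Cons comps_eq by fastforce
qed simp

lemma branch_node:
  assumes "v \<in> verts G" "n \<le> lvl v"
  shows "node (branch v n) \<and> v \<in> region G (branch v n) \<and> length (branch v n) = n"
  using assms(2)
proof (induction n)
  case 0
  then show ?case using assms(1) by (auto intro: node_Nil)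
next
  case (Suc n)
  let ?D = "{y. conn G (verts G - U n) v y}"
  have v: "v \<in> verts G - U n" using Suc assms in_U_iff by fastforce
  have IH: "node (branch v n)" "v \<in> region G (branch v n)" "length (branch v n) = n" using Suc by auto
  have "?D \<subseteq> region G (branch v n)"
  proof (cases n)
    case 0
    then show ?thesis using conn_in[of G "verts G - U n" v] by auto
  next
    case (Suc k)
    then have "verts G - U n \<subseteq> verts G - U k" using U_mono[of k n] by auto
    then show ?thesis using Suc by (auto intro: conn_mono)
  qed
  moreover have "?D \<in> comps G (verts G - U n)" using v by (auto simp: comps_def)
  ultimately show ?case using IH v by (auto intro: node_Cons conn_refl)
qed

lemma suffix_branch: "n \<le> m \<Longrightarrow> suffix (branch v n) (branch v m)"
  by (induction m rule: dec_induct) (auto simp: suffix_Cons)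

lemma suffix_iff_branch: "v \<in> verts G \<Longrightarrow> node x \<Longrightarrow> v \<in> region G x \<Longrightarrow> suffix x (branch v (lvl v))"
  using node_branch suffix_branch by metis

lemma nbh_region: "node (D # xs) \<Longrightarrow> nbh G D \<subseteq> U (length xs) \<and> finite (nbh G D)"
  using nbh_comps[OF graph] U_adhesion by (auto elim!: node_ConsE)

text \<open>A vertex of \<open>U n\<close> adjacent to \<open>D\<close> would put a vertex of
  \<open>D\<close> into \<open>U (Suc n)\<close>, which is already removed. This makes the
  neighbourhoods along an infinite chain leave every \<open>U n\<close>.\<close>

lemma nbh_region_disjoint: "node (D # xs) \<Longrightarrow> n < length xs \<Longrightarrow> nbh G D \<inter> U n = {}"
proof -
  assume D: "node (D # xs)" "n < length xs"
  have "D \<inter> U (length xs) = {}" using D(1) comps_sub by (fastforce elim!: node_ConsE)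
  moreover have "U n \<union> nbh G (U n) \<subseteq> U (length xs)"
    using U_step[of n] U_mono[of "Suc n" "length xs"] D(2) by auto
  moreover have "D \<subseteq> verts G" using region_verts[OF D(1)] by simp
  ultimately show "nbh G D \<inter> U n = {}"
    using adj_sym[OF graph] by (fastforce simp: nbh_def)
qed

lemma finite_cut_region: "node xs \<Longrightarrow> finite_cut G (region G xs)"
  using region_verts[of xs] nbh_region
  by (cases xs) (auto simp: finite_cut_def nbh_def[of G "verts G"])

lemma part_verts: "part xs \<subseteq> verts G"
  using U_verts by (auto simp: part_def nbh_def)

text \<open>A vertex of the part that is missing from the parent's part must lie in \<open>D\<close>
  and have level exactly the length of the node, so the node is where the vertex first
  appears.\<close>

lemma part_step:
  assumes "node (D # xs)" "v \<in> part (D # xs)"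
  shows "v \<in> part xs \<or> D # xs = branch v (lvl v)"
proof (cases "v \<in> D")
  case True
  then have "v \<in> U (Suc (length xs))" using assms(2) by (auto simp: part_def nbh_def)
  moreover have "v \<in> verts G" using assms part_verts by blast
  ultimately have "lvl v \<le> length (D # xs)" using in_U_iff by simp
  moreover have "D # xs = branch v (length (D # xs)) \<and> length (D # xs) \<le> lvl v"
    using node_branch[OF assms(1)] True by simp
  ultimately show ?thesis by (metis le_antisym)
next
  case False
  then have v: "v \<in> nbh G D" using assms(2) by (auto simp: part_def)
  have "D \<subseteq> region G xs" using assms(1) by (auto elim: node_ConsE)
  then have "v \<in> region G xs \<or> v \<in> nbh G (region G xs)" using v by (auto simp: nbh_def)
  then show ?thesis using v nbh_region[OF assms(1)] by (auto simp: part_def)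
qed

lemma part_branch:
  assumes "v \<in> verts G"
  shows "v \<in> part (branch v (lvl v))" "node (branch v (lvl v))"
  using branch_node[OF assms, of "lvl v"] in_U_iff[OF assms] by (auto simp: part_def)

text \<open>Moving towards the root along \<open>part_step\<close> shows that
  \<open>branch v (lvl v)\<close> is the topmost node whose part contains v.\<close>

lemma part_suffix:
  assumes "node xs" "v \<in> part xs"
  shows "suffix (branch v (lvl v)) xs"
  using assms
proof (induction xs rule: list.induct)
  case Nil
  then have "lvl v = 0" using in_U_iff[of v 0] by (auto simp: part_def nbh_def)
  then show ?case by simp
next
  case (Cons D xs)
  then show ?case using part_step[OF Cons(2,3)] node_tl[OF Cons(2)] by (auto intro: suffix_ConsI)
qed

lemma part_between:
  assumes "node xs" "v \<in> part xs" "suffix ys xs" "suffix (branch v (lvl v)) ys"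
  shows "v \<in> part ys"
  using assms
proof (induction xs rule: list.induct)
  case Nil
  then show ?case by simp
next
  case (Cons D xs)
  show ?case
  proof (cases "ys = D # xs")
    case False
    then have s: "suffix ys xs" using Cons(4) by (simp add: suffix_Cons)
    have "length (branch v (lvl v)) \<le> length xs"
      using s Cons(5) suffix_length_le le_trans by blast
    then have "length (branch v (lvl v)) \<noteq> length (D # xs)" by simp
    then have "v \<in> part xs" using part_step[OF Cons(2,3)] by metis
    then show ?thesis using Cons s node_tl by blast
  qed (use Cons in auto)
qed

section \<open>The decomposition tree and its edge separations\<close>

lemma adj_T: "adj T x y \<longleftrightarrow> (\<exists>D. y = D # x \<and> node y) \<or> (\<exists>D. x = D # y \<and> node x)"
  by (auto simp: T_def doubleton_eq_iff)

lemma verts_T [simp]: "verts T = Collect node"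
  by (simp add: T_def)

lemma graph_T: "graph T"
  by (auto simp: graph_def T_def card_insert_if intro: node_tl)

lemma below_attach:
  assumes "adj T x y" "x \<in> below u" "y \<notin> below u"
  shows "y = tl u \<and> x = u"
  using assms by (auto simp: adj_T below_def suffix_Cons dest: node_tl)

lemma above_attach:
  assumes "adj T x y" "x \<notin> below u" "y \<in> below u"
  shows "y = u \<and> x = tl u"
  using below_attach[of y x u] assms by (auto simp: insert_commute)

lemma below_verts: "below u \<subseteq> verts T"
  by (auto simp: below_def)

lemma finite_cut_below: "finite_cut T (below u)"
proof -
  have "nbh T (below u) \<subseteq> {tl u}" using below_attach by (fastforce simp: nbh_def)
  then show ?thesis using below_verts finite_subset by (fastforce simp: finite_cut_def)
qed

lemma conn_below: "z \<in> below u \<Longrightarrow> conn T (below u) u z"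
proof (induction z)
  case Nil
  then show ?case by (auto simp: below_def intro: conn_refl)
next
  case (Cons D z)
  show ?case
  proof (cases "D # z = u")
    case False
    then have "z \<in> below u" using Cons(2) by (auto simp: below_def suffix_Cons dest: node_tl)
    moreover have "adj T z (D # z)" using Cons(2) by (auto simp: adj_T below_def)
    ultimately show ?thesis using Cons conn_step[of T "below u" u z "D # z"] by blast
  qed (use Cons in \<open>auto intro: conn_refl\<close>)
qed

text \<open>The walk from the root runs through the suffixes of z, none of which lies below u when z
  does not.\<close>

lemma conn_not_below: "u \<noteq> [] \<Longrightarrow> node z \<Longrightarrow> z \<notin> below u \<Longrightarrow> conn T (verts T - below u) [] z"
proof (induction z)
  case Nil
  then show ?case by (auto intro: conn_refl)
next
  case (Cons D z)
  then have z: "node z" "z \<notin> below u" by (auto simp: below_def suffix_Cons dest: node_tl)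
  moreover have "adj T z (D # z)" using Cons by (auto simp: adj_T)
  ultimately show ?case using Cons conn_step[of T "verts T - below u" "[]" z "D # z"] by simp
qed

lemma tree_side_child:
  assumes "node (D # xs)"
  shows "tree_side T xs (D # xs) = below (D # xs)"
proof -
  let ?e = "{xs, D # xs}" let ?T = "del_edge T {xs, D # xs}"
  have g: "graph ?T" by (rule graph_del_edge[OF graph_T])
  have v: "verts ?T = verts T" by (simp add: del_edge_def)
  have u: "D # xs \<in> below (D # xs)" "xs \<notin> below (D # xs)"
    using assms by (auto simp: below_def dest: suffix_length_le)
  have "nbh ?T (below (D # xs)) = {}"
    using below_attach[of _ _ "D # xs"] by (fastforce simp: nbh_def del_edge_def insert_commute)
  then have "z \<in> below (D # xs)" if "conn ?T (verts T) (D # xs) z" for z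
    using conn_stays[OF g that] u by auto
  moreover have "conn ?T (verts T) (D # xs) z" if "z \<in> below (D # xs)" for z
    using conn_del_edge[OF conn_below[OF that], of ?e] u below_verts by (auto intro: conn_mono)
  ultimately show ?thesis
    unfolding tree_side_def component_of_conn[OF g] v by blast
qed

lemma tree_side_parent:
  assumes "node (D # xs)"
  shows "tree_side T (D # xs) xs = verts T - below (D # xs)"
proof -
  let ?e = "{D # xs, xs}" let ?T = "del_edge T {D # xs, xs}" let ?A = "verts T - below (D # xs)"
  have g: "graph ?T" by (rule graph_del_edge[OF graph_T])
  have v: "verts ?T = verts T" by (simp add: del_edge_def)
  have u: "D # xs \<in> below (D # xs)" "xs \<notin> below (D # xs)" "node xs"
    using assms by (auto simp: below_def dest: suffix_length_le node_tl)
  have "nbh ?T ?A = {}"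
    using above_attach[of _ _ "D # xs"] by (fastforce simp: nbh_def del_edge_def insert_commute)
  then have "z \<in> ?A" if "conn ?T (verts T) xs z" for z
    using conn_stays[OF g that, of ?A] u by auto
  moreover have "conn ?T (verts T) xs z" if "z \<in> ?A" for z
  proof -
    have c: "conn T ?A [] z" "conn T ?A [] xs" using conn_not_below[of "D # xs"] that u by auto
    have "conn T ?A xs z" using c conn_sym conn_trans by metis
    then show ?thesis using conn_del_edge[of T ?A xs z ?e] u by (auto elim: conn_mono)
  qed
  ultimately show ?thesis
    unfolding tree_side_def component_of_conn[OF g] v by blast
qed

text \<open>Every node is joined to the root through its suffixes. On a cycle, a longest list would
  have two distinct neighbours, both equal to its tail.\<close>

lemma tree_T: "tree T"
  unfolding tree_def
proof (intro conjI ballI notI)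
  show "graph T" by (rule graph_T)
  show "verts T = {} \<Longrightarrow> False" using node_Nil by auto
next
  fix u v assume "u \<in> verts T" "v \<in> verts T"
  then have "conn T (below []) [] u" "conn T (below []) [] v"
    by (intro conn_below; simp add: below_def)+
  then have "conn T (below []) u v" using conn_sym conn_trans by metis
  then show "\<exists>p. path_between T u p v"
    using conn_path[OF graph_T] below_verts by blast
next
  assume "\<exists>p. cycle T p"
  then obtain p where p: "cycle T p" by blast
  then have suc: "successively (adj T) p" "distinct p" "length p \<ge> 3" "adj T (last p) (hd p)"
    by (auto simp: cycle_def path_def)
  define u where "u = (ARG_MAX length x. x \<in> set p)"
  have fin: "\<forall>x. x \<in> set p \<longrightarrow> length x < Suc (Max (length ` set p))"
    by (auto simp: less_Suc_eq_le)
  have "hd p \<in> set p" using suc(3) by (cases p) auto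
  then have u: "u \<in> set p" "\<And>x. x \<in> set p \<Longrightarrow> length x \<le> length u"
    using arg_max_nat_lemma[of "\<lambda>x. x \<in> set p" "hd p" length] fin unfolding u_def by blast+
  have nb: "x = tl u" if "x \<in> set p" "adj T u x \<or> adj T x u" for x
    using u(2)[OF that(1)] that(2) by (auto simp: adj_T)
  \<comment> \<open>The cases reflect that the two neighbours of u on the cycle may be separated by
    the point where the list wraps around.\<close>
  obtain as bs where ab: "p = as @ u # bs" using u(1) by (auto simp: in_set_conv_decomp)
  show False
  proof (cases "as = [] \<or> bs = []")
    case False
    then have "adj T (last as) u" "adj T u (hd bs)" "last as \<in> set as" "hd bs \<in> set bs"
      using suc(1) ab by (auto simp: successively_append_iff successively_Cons)
    then show ?thesis using nb[of "last as"] nb[of "hd bs"] ab suc(2) by auto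
  next
    case True
    then show ?thesis
    proof
      assume "as = []"
      then obtain b c ds where bs: "bs = b # c # ds" using ab suc(3)
        by (cases bs; cases "tl bs") auto
      then have "adj T u b" "adj T (last (c # ds)) u" "last (c # ds) \<in> set (c # ds)"
        using suc(1,4) ab \<open>as = []\<close> by (auto simp: successively_Cons simp del: last.simps) (auto split: if_splits)
      then show False using nb[of b] nb[of "last (c # ds)"] ab bs suc(2) by auto
    next
      assume "bs = []"
      then obtain cs b where as: "as = cs @ [b]" using ab suc(3)
        by (cases as rule: rev_cases) auto
      then have "cs \<noteq> []" using ab suc(3) \<open>bs = []\<close> by auto
      then have "adj T b u" "adj T u (hd cs)" "hd cs \<in> set cs"
        using suc(1,4) ab as \<open>bs = []\<close> by (auto simp: successively_append_iff)
      then show False using nb[of b] nb[of "hd cs"] ab as suc(2) by auto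
    qed
  qed
qed

text \<open>The nodes carrying v lie below \<open>branch v (lvl v)\<close> and are closed under
  moving up to it. If a path between two of them used a node u not carrying v, it would have to
  enter and leave either the subtree at u or the complement of the subtree at
  \<open>branch v (lvl v)\<close>, and each of these is attached through a single vertex.\<close>

lemma part_convex:
  assumes p: "path_between T t p w" and v: "v \<in> part t" "v \<in> part w" and u: "u \<in> set p"
  shows "v \<in> part u"
proof (rule ccontr)
  assume nu: "v \<notin> part u"
  let ?s = "branch v (lvl v)"
  have "t \<in> set p" "w \<in> set p" "set p \<subseteq> verts T"
    using p by (auto simp: path_between_def path_def)
  then have n: "node t" "node w" "node u" using u by auto
  have s: "suffix ?s t" "suffix ?s w" using part_suffix n v by auto
  show False
  proof (cases "suffix ?s u")
    case True
    have "t \<notin> below u" "w \<notin> below u" using part_between True n v nu by (auto simp: below_def)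
    then have "set p \<inter> below u = {}"
      using path_avoids[OF p, of "below u" "tl u"] below_attach by blast
    then show False using u n by (auto simp: below_def)
  next
    case False
    have "set p \<inter> (verts T - below ?s) = {}"
    proof (rule path_avoids[OF p])
      show "t \<notin> verts T - below ?s" "w \<notin> verts T - below ?s" using s n by (auto simp: below_def)
      fix x y assume "adj T x y" "x \<in> verts T - below ?s" "y \<notin> verts T - below ?s"
      then show "y = ?s" using above_attach[of x y ?s] adj_verts[OF graph_T, of x y] by blast
    qed
    then show False using u n False by (auto simp: below_def)
  qed
qed

text \<open>The node where the endpoint of larger level first appears also carries the other
  endpoint, either inside its region or as a neighbour of the region.\<close>

lemma edge_in_part:
  assumes "e \<in> edges G"
  shows "\<exists>t. node t \<and> e \<subseteq> part t"
proof -
  have *: "\<exists>t. node t \<and> {x, y} \<subseteq> part t" if xy: "adj G x y" "lvl x \<le> lvl y" for x y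
  proof -
    have V: "x \<in> verts G" "y \<in> verts G" using adj_verts[OF graph] xy by blast+
    have "x \<in> part (branch y (lvl y))"
    proof (cases "x \<in> region G (branch y (lvl y))")
      case True
      then show ?thesis using branch_node[OF V(2)] in_U_iff[OF V(1)] xy by (auto simp: part_def)
    next
      case False
      then show ?thesis using branch_node[OF V(2)] xy V adj_sym[OF graph xy(1)] by (auto simp: part_def nbh_def)
    qed
    then show ?thesis using part_branch[OF V(2)] by blast
  qed
  obtain x y where "e = {x, y}" using assms graph by (auto simp: graph_def card_2_iff)
  then show ?thesis using *[of x y] *[of y x] assms by (cases "lvl x \<le> lvl y") (auto simp: insert_commute)
qed

lemma tree_decomposition_T: "tree_decomposition G T P"
  unfolding tree_decomposition_def
proof (intro conjI ballI allI impI)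
  show "tree T" by (rule tree_T)
  fix t assume "t \<in> verts T"
  show "subgraph (P t) G"
    using graph part_verts[of t] by (auto simp: subgraph_def graph_def P_def)
next
  fix v assume "v \<in> verts G"
  then show "\<exists>t\<in>verts T. v \<in> verts (P t)" using part_branch[of v] by (auto simp: P_def)
next
  fix e assume "e \<in> edges G"
  then show "\<exists>t\<in>verts T. e \<in> edges (P t)" using edge_in_part[of e] by (auto simp: P_def)
next
  fix t w p u assume "path_between T t p w" "u \<in> set p"
  then show "verts (P t) \<inter> verts (P w) \<subseteq> verts (P u)" using part_convex by (auto simp: P_def)
qed

lemma finite_adhesion_T: "finite_adhesion T P"
  unfolding finite_adhesion_def
proof (intro allI impI)
  have *: "finite (part xs \<inter> part (D # xs))" if D: "node (D # xs)" for xs D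
  proof -
    have "D \<inter> U (length xs) = {}" using D comps_sub by (fastforce elim!: node_ConsE)
    moreover have "D \<inter> nbh G (region G xs) = {}" using D by (auto elim!: node_ConsE simp: nbh_def)
    \<comment> \<open>\<open>D\<close> is disjoint from both pieces of the parent's part, so only
      the neighbourhood of \<open>D\<close> can be shared.\<close>
    ultimately have "part xs \<inter> part (D # xs) \<subseteq> nbh G D" by (auto simp: part_def)
    then show ?thesis using nbh_region[OF D] finite_subset by blast
  qed
  fix t u assume "adj T t u"
  then show "finite (verts (P t) \<inter> verts (P u))"
    using * by (auto simp: adj_T P_def Int_commute)
qed

lemma side_child:
  assumes "node (D # xs)"
  shows "side T P xs (D # xs) = D \<union> nbh G D"
proof -
  let ?u = "D # xs"
  have "part x \<subseteq> D \<union> nbh G D" if x: "x \<in> below ?u" for x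
  proof -
    have "node x" "region G x \<subseteq> D" using x node_suffix[of ?u x] by (auto simp: below_def)
    then show ?thesis by (auto simp: part_def nbh_def)
  qed
  moreover have "v \<in> (\<Union>x\<in>below ?u. part x)" if v: "v \<in> D" for v
  proof -
    have "v \<in> verts G" using v region_verts[OF assms] by auto
    then show ?thesis using part_branch[of v] suffix_iff_branch[OF _ assms, of v] v by (auto simp: below_def)
  qed
  moreover have "nbh G D \<subseteq> (\<Union>x\<in>below ?u. part x)"
    using assms by (force simp: below_def part_def)
  ultimately show ?thesis unfolding side_def tree_side_child[OF assms] P_def by auto
qed

text \<open>Any node whose part meets \<open>D\<close> extends the node where that vertex first
  appears, and hence lies below \<open>D # xs\<close>. So the two sides of a tree edge overlap
  exactly in the neighbourhood of \<open>D\<close>.\<close>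

lemma side_parent:
  assumes "node (D # xs)"
  shows "side T P (D # xs) xs = verts G - D"
proof -
  let ?u = "D # xs"
  have out: "v \<notin> D" if x: "node x" "x \<notin> below ?u" "v \<in> part x" for v x
  proof
    assume "v \<in> D"
    moreover have "v \<in> verts G" using x part_verts by blast
    ultimately have "suffix ?u (branch v (lvl v))" using suffix_iff_branch[OF _ assms] by simp
    then show False using part_suffix[OF x(1,3)] x by (auto simp: below_def)
  qed
  have covered: "\<exists>x. node x \<and> x \<notin> below ?u \<and> v \<in> part x" if v: "v \<in> verts G - D" for v
  proof -
    have "\<not> suffix ?u (branch v (lvl v))"
      using node_suffix[of ?u "branch v (lvl v)"] branch_node[of v "lvl v"] v by auto
    then show ?thesis using part_branch[of v] v by (auto simp: below_def)
  qed
  have "(\<Union>x\<in>verts T - below ?u. part x) = verts G - D"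
  proof (intro equalityI subsetI)
    fix v assume "v \<in> (\<Union>x\<in>verts T - below ?u. part x)"
    then show "v \<in> verts G - D" using out part_verts by auto
  next
    fix v assume "v \<in> verts G - D"
    then show "v \<in> (\<Union>x\<in>verts T - below ?u. part x)" using covered[of v] by auto
  qed
  then show ?thesis by (simp add: side_def tree_side_parent[OF assms] P_def)
qed

end


section \<open>Ends of the decomposition tree\<close>

context exhaustion
begin

lemma region_level:
  assumes "node x" "node y" "length x = length y" "v \<in> region G x" "v \<in> region G y"
  shows "x = y"
  using node_branch[OF assms(1,4)] node_branch[OF assms(2,5)] assms(3) by metis

text \<open>For both the end of G and the end of T, the direction of a tree edge towards the parent
  is the negation of the direction towards the child. So agreement of the orientations need only be
  tested on the child sides.\<close>

lemma lives_in_end_iff: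
  assumes \<omega>: "\<omega> \<in> vertex_ends G" "R \<in> \<omega>" and \<eta>: "\<eta> \<in> vertex_ends T" "N \<in> \<eta>"
  shows "lives_in_end T P \<omega> \<eta> \<longleftrightarrow>
    (\<forall>x. node x \<longrightarrow> x \<noteq> [] \<longrightarrow> (tail_in R (region G x) \<longleftrightarrow> tail_in N (below x)))"
proof -
  have child: "lives_in_set \<omega> (side T P xs (D # xs)) \<longleftrightarrow> tail_in R D"
    "lives_in_set \<eta> (tree_side T xs (D # xs)) \<longleftrightarrow> tail_in N (below (D # xs))"
    and parent: "lives_in_set \<omega> (side T P (D # xs) xs) \<longleftrightarrow> \<not> tail_in R D"
    "lives_in_set \<eta> (tree_side T (D # xs) xs) \<longleftrightarrow> \<not> tail_in N (below (D # xs))"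
    if D: "node (D # xs)" for D xs
  proof -
    have c: "finite_cut G D" using finite_cut_region[OF D] by simp
    then have "finite (D \<union> nbh G D - D)" by (simp add: finite_cut_def Un_Diff)
    then show "lives_in_set \<omega> (side T P xs (D # xs)) \<longleftrightarrow> tail_in R D"
      unfolding side_child[OF D] by (intro lives_in_cut_iff[OF graph \<omega> c]) auto
    show "lives_in_set \<omega> (side T P (D # xs) xs) \<longleftrightarrow> \<not> tail_in R D"
      unfolding side_parent[OF D] by (rule lives_outside_cut_iff[OF graph \<omega> c])
    show "lives_in_set \<eta> (tree_side T xs (D # xs)) \<longleftrightarrow> tail_in N (below (D # xs))"
      unfolding tree_side_child[OF D] by (intro lives_in_cut_iff[OF graph_T \<eta> finite_cut_below]) auto
    show "lives_in_set \<eta> (tree_side T (D # xs) xs) \<longleftrightarrow> \<not> tail_in N (below (D # xs))"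
      unfolding tree_side_parent[OF D] by (rule lives_outside_cut_iff[OF graph_T \<eta> finite_cut_below])
  qed
  have "lives_in_end T P \<omega> \<eta> \<longleftrightarrow> (\<forall>t u. adj T t u \<longrightarrow>
      (lives_in_set \<omega> (side T P t u) \<longleftrightarrow> lives_in_set \<eta> (tree_side T t u)))"
    unfolding lives_in_end_def points_towards_end_def orientation_of_def by blast
  also have "\<dots> \<longleftrightarrow> (\<forall>D xs. node (D # xs) \<longrightarrow> (tail_in R D \<longleftrightarrow> tail_in N (below (D # xs))))"
  proof (rule iffI; intro allI impI)
    fix D xs assume *: "\<forall>t u. adj T t u \<longrightarrow>
      (lives_in_set \<omega> (side T P t u) \<longleftrightarrow> lives_in_set \<eta> (tree_side T t u))" "node (D # xs)"
    then have "adj T xs (D # xs)" by (simp add: adj_T)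
    then show "tail_in R D \<longleftrightarrow> tail_in N (below (D # xs))" using * child by blast
  next
    fix t u assume *: "\<forall>D xs. node (D # xs) \<longrightarrow> (tail_in R D \<longleftrightarrow> tail_in N (below (D # xs)))" "adj T t u"
    from *(2) consider D where "u = D # t" "node u" | D where "t = D # u" "node t"
      unfolding adj_T by blast
    then show "lives_in_set \<omega> (side T P t u) \<longleftrightarrow> lives_in_set \<eta> (tree_side T t u)"
      using *(1) child parent by cases auto
  qed
  also have "\<dots> \<longleftrightarrow> (\<forall>x. node x \<longrightarrow> x \<noteq> [] \<longrightarrow> (tail_in R (region G x) \<longleftrightarrow> tail_in N (below x)))"
    by (auto simp: neq_Nil_conv)
  finally show ?thesis .
qed

lemma below_level:
  assumes "z \<in> below x" "z \<in> below y" "length x = length y"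
  shows "x = y"
  using assms unfolding below_def by (metis mem_Collect_eq suffix_length_suffix suffix_order.antisym order_refl)

text \<open>Once the ray has a tail below x, it eventually avoids x itself and is then confined to
  the subtree of one child, since x is the only way out. Iterating from the root gives an infinite
  branch.\<close>

lemma tree_ray_branch:
  assumes N: "ray T N"
  shows "\<exists>b. \<forall>n. node (b n) \<and> length (b n) = n \<and> tail_in N (below (b n)) \<and> (\<exists>D. b (Suc n) = D # b n)"
proof -
  have step: "\<exists>D. node (D # x) \<and> tail_in N (below (D # x))"
    if x: "node x" "tail_in N (below x)" for x
  proof -
    have "tail_in N (below x \<inter> - {x})"
      using N x by (intro tail_in_Int tail_in_avoid_finite) (auto simp: ray_def)
    then obtain m where m: "\<And>i. i \<ge> m \<Longrightarrow> N i \<in> below x \<and> N i \<noteq> x" by (auto simp: tail_in_def)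
    obtain ys where "N m = ys @ x" "node (N m)" "ys \<noteq> []"
      using m[of m] by (auto simp: below_def suffix_def)
    then obtain zs D where zs: "N m = zs @ D # x" by (cases ys rule: rev_cases) auto
    then have D: "node (D # x)" "N m \<in> below (D # x)"
      using \<open>node (N m)\<close> node_suffix[of "D # x" "N m"] by (auto simp: below_def suffix_def)
    have "nbh T (below (D # x)) \<subseteq> {x}"
      using below_attach[of _ _ "D # x"] by (fastforce simp: nbh_def)
    then have "N i \<in> below (D # x)" if "i \<ge> m" for i
      using ray_stays[where G = T and R = N and m = m and D = "below (D # x)" and i = i]
        graph_T N D m that by blast
    then have "tail_in N (below (D # x))" by (auto simp: tail_in_def)
    then show ?thesis using D by blast
  qed
  then obtain f where f: "\<And>x. node x \<Longrightarrow> tail_in N (below x) \<Longrightarrow>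
      node (f x # x) \<and> tail_in N (below (f x # x))"
    by metis
  define b where "b = rec_nat [] (\<lambda>_ x. f x # x)"
  have b: "b 0 = []" "\<And>n. b (Suc n) = f (b n) # b n" by (simp_all add: b_def)
  have "node (b n) \<and> length (b n) = n \<and> tail_in N (below (b n))" for n
  proof (induction n)
    case 0
    have "N i \<in> below []" for i using N by (auto simp: ray_def below_def)
    then show ?case using b by (auto simp: node_Nil tail_in_def)
  next
    case (Suc n)
    then show ?case using f b by simp
  qed
  then show ?thesis using b by blast
qed

section \<open>An infinite branch of the tree and its unique end\<close>

context
  fixes b
  assumes b_node: "\<And>n. node (b n)" and b_length: "\<And>n. length (b n) = n"
    and b_Suc: "\<And>n. \<exists>D. b (Suc n) = D # b n"
begin

text \<open>The index is shifted by one so that \<open>comp_at n\<close> is a component of G -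
  \<open>U n\<close>; the root \<open>b 0\<close> has the whole graph as its region.\<close>

abbreviation comp_at :: "nat \<Rightarrow> 'a set" where
  "comp_at n \<equiv> region G (b (Suc n))"

lemma comp_at_comps: "comp_at n \<in> comps G (verts G - U n)"
proof -
  obtain D where D: "b (Suc n) = D # b n" using b_Suc by blast
  have "node (D # b n)" using b_node[of "Suc n"] D by simp
  then show ?thesis using D b_length[of n] by (auto elim: node_ConsE)
qed

lemma comp_at_nbh: "nbh G (comp_at n) \<subseteq> U n" "finite (nbh G (comp_at n))" "k < n \<Longrightarrow> nbh G (comp_at n) \<inter> U k = {}"
proof -
  obtain D where D: "b (Suc n) = D # b n" using b_Suc by blast
  have n: "node (D # b n)" using b_node[of "Suc n"] D by simp
  show "nbh G (comp_at n) \<subseteq> U n" "finite (nbh G (comp_at n))" "k < n \<Longrightarrow> nbh G (comp_at n) \<inter> U k = {}"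
    using nbh_region[OF n] nbh_region_disjoint[OF n, of k] D b_length[of n] by auto
qed

lemma comp_at_cut: "finite_cut G (comp_at n)"
  using finite_cut_region b_node by blast

lemma comp_at_mono: "m \<le> n \<Longrightarrow> comp_at n \<subseteq> comp_at m"
proof (rule lift_Suc_antimono_le[of comp_at])
  fix n
  obtain D where D: "b (Suc (Suc n)) = D # b (Suc n)" using b_Suc by blast
  then show "comp_at (Suc n) \<subseteq> comp_at n"
    using b_node[of "Suc (Suc n)"] by (auto elim: node_ConsE)
qed

lemma comp_at_disjoint: "k \<le> n \<Longrightarrow> comp_at n \<inter> U k = {}"
  using comps_sub[OF comp_at_comps, of n] U_mono[of k n] by blast

lemma comp_at_Inter: "(\<Inter>n. comp_at n) = {}"
proof (rule ccontr)
  assume "(\<Inter>n. comp_at n) \<noteq> {}"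
  then obtain x where x: "\<And>n. x \<in> comp_at n" by blast
  then have "x \<in> verts G" using comps_sub[OF comp_at_comps] by blast
  then obtain n where "x \<in> U n" using U_cover by blast
  then show False using x[of n] comp_at_disjoint[of n n] by blast
qed

text \<open>One vertex is chosen from each component of the chain and the star-comb lemma is applied
  to these. A star is impossible because its centre lies outside a late component and its
  neighbourhood, on a side that holds only finitely many chosen vertices. For the same reason the
  comb's ray has a tail in every component of the chain.\<close>

lemma branch_ray_exists: "\<exists>R. ray G R \<and> (\<forall>n. tail_in R (comp_at n))"
proof -
  have "\<forall>n. \<exists>x. x \<in> comp_at n" using comps_sub[OF comp_at_comps] by blast
  then obtain f where f: "\<And>n. f n \<in> comp_at n" by metis
  have f': "f k \<in> comp_at n" if "n \<le> k" for k n using f[of k] comp_at_mono[OF that] by blast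
  have sub: "comp_at 0 \<subseteq> verts G" using comps_sub[OF comp_at_comps] by blast
  have out: "finite_cut G (verts G - comp_at n - nbh G (comp_at n))"
    "finite {w \<in> UNIV. f w \<in> verts G - comp_at n - nbh G (comp_at n)}" for n
  proof -
    show "finite_cut G (verts G - comp_at n - nbh G (comp_at n))"
      by (rule cut_outside[OF graph comp_at_cut])
    have "{w \<in> UNIV. f w \<in> verts G - comp_at n - nbh G (comp_at n)} \<subseteq> {..<n}"
      using f' by (auto simp: not_le[symmetric])
    then show "finite {w \<in> UNIV. f w \<in> verts G - comp_at n - nbh G (comp_at n)}"
      by (rule finite_subset) simp
  qed
  have "f ` UNIV \<subseteq> comp_at 0" using f' by auto
  from star_comb[OF graph sub f[of 0] comps_conn[OF comp_at_comps f] this infinite_UNIV_nat]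
  consider c where "c \<in> comp_at 0" "\<And>D. finite_cut G D \<Longrightarrow> c \<in> D \<Longrightarrow> infinite {w \<in> UNIV. f w \<in> D}"
    | R where "ray G R" "\<And>D. finite_cut G D \<Longrightarrow> tail_in R D \<Longrightarrow> infinite {w \<in> UNIV. f w \<in> D}"
    by blast
  then show ?thesis
  proof cases
    case 1
    have c: "c \<in> verts G" using 1(1) sub by blast
    then obtain n where n: "c \<in> U n" using U_cover by blast
    \<comment> \<open>The index \<open>Suc n\<close> rather than \<open>n\<close> is needed since
      \<open>nbh G (comp_at n)\<close> lies in \<open>U n\<close> and may contain
      \<open>c\<close>.\<close>
    then have "c \<notin> nbh G (comp_at (Suc n))" "c \<notin> comp_at (Suc n)"
      using comp_at_nbh(3)[OF lessI, of n] comp_at_disjoint[OF le_SucI, OF order_refl, of n] by blast+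
    then show ?thesis using 1(2)[OF out(1)[of "Suc n"]] out(2)[of "Suc n"] c by blast
  next
    case 2
    have "tail_in R (comp_at n)" for n
    proof (rule ccontr)
      assume "\<not> tail_in R (comp_at n)"
      then have "tail_in R (verts G - comp_at n - nbh G (comp_at n))"
        using ray_decides[OF graph 2(1) comp_at_cut] by blast
      then show False using 2(2)[OF out(1)] out(2) by blast
    qed
    then show ?thesis using 2(1) by blast
  qed
qed

text \<open>The finite neighbourhood of \<open>D\<close> misses \<open>comp_at n\<close> for large
  n, as the chain decreases to the empty set. That component is connected and meets \<open>D\<close>
  in a vertex of R, so it lies in \<open>D\<close> and brings a tail of S with it.\<close>

lemma branch_ray_unique:
  assumes R: "ray G R" "\<And>n. tail_in R (comp_at n)" and S: "ray G S" "\<And>n. tail_in S (comp_at n)"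
  shows "(R, S) \<in> ray_equiv G"
  unfolding ray_equiv_iff[OF graph]
proof (intro conjI allI impI R(1) S(1))
  fix D assume D: "finite_cut G D" "tail_in R D"
  obtain n where n: "nbh G D \<inter> comp_at n = {}"
    using tail_in_decreasing[of "nbh G D" comp_at] D(1) comp_at_mono comp_at_Inter
    by (auto simp: finite_cut_def)
  obtain i where i: "R i \<in> D" "R i \<in> comp_at n" using tail_in_meet[OF D(2) R(2)] by blast
  have "y \<in> D" if "y \<in> comp_at n" for y
    using conn_stays[OF graph comps_conn[OF comp_at_comps i(2) that] i(1)] n by blast
  then show "tail_in S D" using tail_in_mono[OF S(2)] by blast
qed

text \<open>Every vertex belongs to some \<open>U n\<close>, and the next component of the chain
  together with its neighbourhood avoids \<open>U n\<close>. So that component is a cut showing that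
  the vertex does not dominate.\<close>

lemma branch_ray_undominated:
  assumes R: "ray G R" "\<And>n. tail_in R (comp_at n)"
  shows "undominated G R"
  unfolding undominated_def[OF graph]
proof (intro conjI ballI R(1))
  fix v assume "v \<in> verts G"
  then obtain n where "v \<in> U n" using U_cover by blast
  then have "v \<notin> comp_at (Suc n) \<union> nbh G (comp_at (Suc n))"
    using comp_at_nbh(3)[OF lessI, of n] comp_at_disjoint[OF le_SucI, OF order_refl, of n] by blast
  then show "\<exists>D. finite_cut G D \<and> tail_in R D \<and> v \<notin> D \<union> nbh G D"
    using comp_at_cut R(2) by blast
qed

text \<open>On each level the regions are pairwise disjoint, and so are the subtrees. Hence a tail
  on the branch excludes tails at all other nodes of that level, and only the nodes of the branch
  have to be checked.\<close>

lemma lives_in_end_branch: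
  assumes \<omega>: "\<omega> \<in> vertex_ends G" "R \<in> \<omega>" and \<eta>: "\<eta> \<in> vertex_ends T" "N \<in> \<eta>"
    and N: "\<And>n. tail_in N (below (b n))"
  shows "lives_in_end T P \<omega> \<eta> \<longleftrightarrow> (\<forall>n. tail_in R (comp_at n))"
  unfolding lives_in_end_iff[OF \<omega> \<eta>]
proof (rule iffI; intro allI impI)
  fix n assume *: "\<forall>x. node x \<longrightarrow> x \<noteq> [] \<longrightarrow> (tail_in R (region G x) \<longleftrightarrow> tail_in N (below x))"
  have "b (Suc n) \<noteq> []" using b_length[of "Suc n"] by auto
  then show "tail_in R (comp_at n)" using * b_node N by blast
next
  fix x assume R: "\<forall>n. tail_in R (comp_at n)" and x: "node x" "x \<noteq> []"
  then obtain n where n: "length x = Suc n" by (cases x) auto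
  have "tail_in R (region G x) \<longleftrightarrow> x = b (Suc n)"
    using tail_in_meet[of R "region G x" "comp_at n"] R region_level[OF x(1) b_node] n b_length
    by metis
  moreover have "tail_in N (below x) \<longleftrightarrow> x = b (Suc n)"
    using tail_in_meet[of N "below x" "below (b (Suc n))"] N below_level[of _ x "b (Suc n)"] n b_length
    by metis
  ultimately show "tail_in R (region G x) \<longleftrightarrow> tail_in N (below x)" by simp
qed

lemma ray_b: "ray T b"
  unfolding ray_def
proof (intro conjI allI)
  show "inj b" by (rule injI) (metis b_length)
  show "range b \<subseteq> verts T" using b_node by auto
  fix n show "adj T (b n) (b (Suc n))" using b_Suc[of n] b_node[of "Suc n"] by (auto simp: adj_T)
qed

lemma tail_in_b: "tail_in b (below (b n))"
proof -
  have "suffix (b n) (b i)" if "i \<ge> n" for i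
    using that
  proof (induction i rule: dec_induct)
    case (step m)
    then show ?case using b_Suc[of m] by (auto simp: suffix_Cons)
  qed simp
  then show ?thesis using b_node by (auto simp: tail_in_def below_def)
qed

end

text \<open>Being far from \<open>U k\<close>, the ray has a tail in G - \<open>U k\<close> and
  therefore in a single component of it. Components chosen on consecutive levels are nested because
  regions of equal level that share a vertex coincide.\<close>

lemma undominated_branch:
  assumes R: "undominated G R"
  shows "\<exists>b. \<forall>n. node (b n) \<and> length (b n) = n \<and> tail_in R (region G (b n)) \<and> (\<exists>D. b (Suc n) = D # b n)"
proof -
  have r: "ray G R" using R undominated_def[OF graph] by blast
  have "\<exists>x. node x \<and> length x = n \<and> tail_in R (region G x)" for n
  proof (cases n)
    case 0
    have "tail_in R (verts G)" using r by (auto simp: tail_in_def ray_def)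
    then show ?thesis using 0 node_Nil by (intro exI[of _ "[]"]) simp
  next
    case (Suc k)
    obtain D where D: "tail_in R D" "D \<inter> U k = {}" using U_far[OF R] far_iff[OF graph r] by blast
    moreover have "tail_in R (verts G)" using r by (auto simp: tail_in_def ray_def)
    ultimately have "tail_in R (verts G - U k)"
      using tail_in_Int[of R D "verts G"] tail_in_mono[of R "D \<inter> verts G" "verts G - U k"] by blast
    then obtain m where m: "\<And>i. i \<ge> m \<Longrightarrow> R i \<in> verts G - U k" by (auto simp: tail_in_def)
    \<comment> \<open>By definition this is the head of \<open>branch (R m) (Suc k)\<close>, so that
      branch node is the witness.\<close>
    let ?C = "{y. conn G (verts G - U k) (R m) y}"
    have "tail_in R ?C"
      using conn_tail[where G = G and R = R and m = m and A = "verts G - U k"] r m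
      by (auto simp: ray_def tail_in_def)
    moreover have "k < lvl (R m)" using m[of m] in_U_iff[of "R m" k] by auto
    then have "node (branch (R m) n)" "length (branch (R m) n) = n"
      using branch_node[of "R m" n] m[of m] Suc by auto
    ultimately show ?thesis using Suc by (intro exI[of _ "branch (R m) n"]) auto
  qed
  then obtain b where b: "\<And>n. node (b n) \<and> length (b n) = n \<and> tail_in R (region G (b n))" by metis
  have "\<exists>D. b (Suc n) = D # b n" for n
  proof -
    obtain D x where x: "b (Suc n) = D # x" "length x = n" using b[of "Suc n"] by (cases "b (Suc n)") auto
    then have n: "node x" "D \<subseteq> region G x" using b[of "Suc n"] by (auto elim: node_ConsE)
    then have "tail_in R (region G x)" using b[of "Suc n"] x by (auto elim: tail_in_mono)
    then obtain i where "R i \<in> region G x" "R i \<in> region G (b n)" using tail_in_meet b by blast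
    then have "x = b n" using region_level[OF n(1)] b x by auto
    then show ?thesis using x by blast
  qed
  then show ?thesis using b by blast
qed

lemma ends_define: "ends_define_precisely G T P (topological_ends G)"
  unfolding ends_define_precisely_def
proof (intro conjI ballI impI)
  fix \<eta> assume \<eta>: "\<eta> \<in> vertex_ends T"
  then obtain N where N: "ray T N" "N \<in> \<eta>" using vertex_endE[OF graph_T] by metis
  then obtain b where b: "\<And>n. node (b n)" "\<And>n. length (b n) = n" "\<And>n. tail_in N (below (b n))"
    "\<And>n. \<exists>D. b (Suc n) = D # b n" using tree_ray_branch by metis
  note lives = lives_in_end_branch[OF b(1,2,4) _ _ \<eta> N(2) b(3)]
  obtain R where R: "ray G R" "\<And>n. tail_in R (region G (b (Suc n)))"
    using branch_ray_exists[OF b(1,2,4)] by blast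
  let ?\<omega> = "ray_equiv G `` {R}"
  have \<omega>: "?\<omega> \<in> vertex_ends G" "R \<in> ?\<omega>"
    using vertex_end_of_ray[OF graph R(1)] R(1) by (auto simp: ray_equiv_iff[OF graph])
  show "\<exists>!\<omega>. \<omega> \<in> vertex_ends G \<and> lives_in_end T P \<omega> \<eta>"
  proof (intro ex1I[of _ ?\<omega>] conjI \<omega>(1))
    show "lives_in_end T P ?\<omega> \<eta>" using lives[OF \<omega>] R by blast
  next
    fix \<omega> assume w: "\<omega> \<in> vertex_ends G \<and> lives_in_end T P \<omega> \<eta>"
    then obtain S where S: "ray G S" "S \<in> \<omega>" "\<omega> = ray_equiv G `` {S}" using vertex_endE[OF graph] by metis
    then have "\<And>n. tail_in S (region G (b (Suc n)))" using lives[of \<omega> S] w by blast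
    then have "(S, R) \<in> ray_equiv G" using branch_ray_unique[OF b(1,2,4) S(1) _ R] by blast
    then show "\<omega> = ?\<omega>" using S(3) equiv_class_eq[OF equiv_ray_equiv[OF graph]] by simp
  qed
  fix \<omega> assume w: "\<omega> \<in> vertex_ends G" "lives_in_end T P \<omega> \<eta>"
  then obtain S where S: "ray G S" "S \<in> \<omega>" using vertex_endE[OF graph] by metis
  then have "\<And>n. tail_in S (region G (b (Suc n)))" using lives[of \<omega> S] w by blast
  then have "undominated G S" using branch_ray_undominated[OF b(1,2,4) S(1)] by blast
  then show "\<omega> \<in> topological_ends G" using topological_end_iff[OF graph w(1) S(2)] by blast
next
  fix \<omega> assume top: "\<omega> \<in> topological_ends G"
  then have w: "\<omega> \<in> vertex_ends G" by (simp add: topological_ends_def)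
  then obtain R where R: "ray G R" "R \<in> \<omega>" using vertex_endE[OF graph] by metis
  then have "undominated G R" using topological_end_iff[OF graph w R(2)] top by blast
  then obtain b where b: "\<And>n. node (b n)" "\<And>n. length (b n) = n" "\<And>n. tail_in R (region G (b n))"
    "\<And>n. \<exists>D. b (Suc n) = D # b n" using undominated_branch by metis
  have r: "ray T b" by (rule ray_b[OF b(1,2,4)])
  let ?\<eta> = "ray_equiv T `` {b}"
  have \<eta>: "?\<eta> \<in> vertex_ends T" "b \<in> ?\<eta>"
    using vertex_end_of_ray[OF graph_T r] r by (auto simp: ray_equiv_iff[OF graph_T])
  have "lives_in_end T P \<omega> ?\<eta>"
    using lives_in_end_branch[OF b(1,2,4) w R(2) \<eta> tail_in_b[OF b(1,2,4)]] b(3) by blast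
  then show "\<exists>\<eta>\<in>vertex_ends T. lives_in_end T P \<omega> \<eta>" using \<eta> by blast
qed

end

theorem theorem1:
  fixes G :: "'a ugraph"
  assumes "graph G"
  shows "\<exists>(T :: 'a node ugraph) (P :: 'a node \<Rightarrow> 'a ugraph).
           tree_decomposition G T P \<and> finite_adhesion T P \<and>
           ends_define_precisely G T P (topological_ends G)"
proof -
  obtain U where U: "\<And>n. U n \<subseteq> verts G" "\<And>n. U n \<union> nbh G (U n) \<subseteq> U (Suc n)" "(\<Union>n. U n) = verts G"
    "\<And>n C. C \<in> comps G (verts G - U n) \<Longrightarrow> finite (nbh G C)"
    "\<And>n R. undominated G R \<Longrightarrow> far G R (U n)"
    using exhaustion_exists[OF assms] by metis
  interpret exhaustion G U by unfold_locales (use assms U in auto)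
  show ?thesis
    using tree_decomposition_T finite_adhesion_T ends_define by blast
qed

end
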